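(* Let $R$ be a polynomial ring over a field $K$ with graded maximal ideal $\mathfrak{m}$. Let $I\subset R$ be a graded ideal for which $C(I)$ is $\mathfrak{m}$-primary. Then $\dim\mathcal{R}(I)=\dim S(I)$ if and only if $\mu(I)\leq\dim R+1$.
   Context: All rings are commutative with unit, $\dim$ is Krull dimension, $\mu(I)$ is the minimal number of generators of $I$, and polynomial rings in finitely many variables carry the standard grading. For a Noetherian ring $R$ and an ideal $I=(f_1,\ldots,f_m)\subseteq R$, let $\mathcal{R}(I)=R[f_1t,\ldots,f_mt]\subseteq R[t]$ be the Rees algebra, $T=R[y_1,\ldots,y_m]$ a polynomial ring, $\varphi:T\to\mathcal{R}(I)$ the $R$-algebra homomorphism with $\varphi(y_j)=f_jt$, and $J=\ker\varphi$. Let $L\subseteq J$ be the ideal of $T$ generated by all linear relations $\sum_{i=1}^m a_iy_i$ with $a_i\in R$ and $\sum_i a_if_i=0$. Then $T/L\cong S(I)$ is the symmetric algebra of $I$, and the kernel of the canonical epimorphism $\alpha:S(I)\to\mathcal{R}(I)$ is $J/L$. The conductor of $I$ is the ideal $C(I)=L:_RJ=\{r\in R: rJ\subseteq L\}=\mathrm{Ann}_R(\ker\alpha)$ of $R$; it does not depend on the chosen generators. *)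

theory Defs
  imports
    "HOL-Algebra.QuotRing"
    "HOL-Algebra.Generated_Rings"
    "HOL-Computational_Algebra.Polynomial"
    "HOL-Library.Poly_Mapping"
    "HOL-Library.Extended_Real"
begin

section \<open>Rings, ideals, dimension\<close>

definition subring_of :: "'a::comm_ring_1 set \<Rightarrow> 'a ring" where
  "subring_of A = \<lparr>carrier = A, monoid.mult = (*), one = 1, ring.zero = 0, add = (+)\<rparr>"

text \<open>Supremum of the lengths of chains of prime ideals; the zero ring gets dimension
  \<open>-\<infinity>\<close>, the supremum of the empty set.\<close>

definition krull_dim :: "('a, 'b) ring_scheme \<Rightarrow> ereal" where
  "krull_dim R = (SUP k \<in> {k :: nat. \<exists>P :: nat \<Rightarrow> 'a set.
      (\<forall>i\<le>k. primeideal (P i) R) \<and> (\<forall>i<k. P i \<subset> P (Suc i))}. ereal (real k))"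

text \<open>The value is \<open>\<infinity>\<close> if the ideal is not finitely generated.\<close>

definition min_num_gens :: "('a, 'b) ring_scheme \<Rightarrow> 'a set \<Rightarrow> enat" where
  "min_num_gens R I =
    (INF S \<in> {S. finite S \<and> S \<subseteq> carrier R \<and> I = Idl\<^bsub>R\<^esub> S}. enat (card S))"

definition primary_ideal :: "'a set \<Rightarrow> ('a, 'b) ring_scheme \<Rightarrow> bool" where
  "primary_ideal Q R \<longleftrightarrow> ideal Q R \<and> Q \<noteq> carrier R \<and>
    (\<forall>a\<in>carrier R. \<forall>b\<in>carrier R. a \<otimes>\<^bsub>R\<^esub> b \<in> Q \<longrightarrow>
      a \<in> Q \<or> (\<exists>k::nat. b [^]\<^bsub>R\<^esub> k \<in> Q))"

definition radical :: "('a, 'b) ring_scheme \<Rightarrow> 'a set \<Rightarrow> 'a set" where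
  "radical R Q = {a \<in> carrier R. \<exists>k::nat. a [^]\<^bsub>R\<^esub> k \<in> Q}"

text \<open>\<open>primary_to R P Q\<close>: the ideal \<open>Q\<close> is \<open>P\<close>-primary.\<close>

definition primary_to :: "('a, 'b) ring_scheme \<Rightarrow> 'a set \<Rightarrow> 'a set \<Rightarrow> bool" where
  "primary_to R P Q \<longleftrightarrow> primary_ideal Q R \<and> radical R Q = P"

section \<open>Polynomial rings in several variables\<close>

text \<open>Exponent vectors are finitely supported functions \<open>'v \<Rightarrow>\<^sub>0 nat\<close>, and the multiplication
  of \<open>('v \<Rightarrow>\<^sub>0 nat) \<Rightarrow>\<^sub>0 'a\<close> is the convolution product.\<close>

type_synonym ('v, 'a) mpoly = "('v \<Rightarrow>\<^sub>0 nat) \<Rightarrow>\<^sub>0 'a"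

text \<open>The polynomial ring \<open>A[x\<^sub>v | v \<in> V]\<close>, where \<open>A\<close> is a subring of a type. Both the
  coefficients and the variables are restricted by sets, so that the construction can be iterated
  and the number of variables can be any natural number, including \<open>0\<close>.\<close>

definition mpoly_ring :: "'a::comm_ring_1 set \<Rightarrow> 'v set \<Rightarrow> ('v, 'a) mpoly ring" where
  "mpoly_ring A V = subring_of {p. \<forall>\<alpha>\<in>Poly_Mapping.keys p.
      Poly_Mapping.lookup p \<alpha> \<in> A \<and> Poly_Mapping.keys \<alpha> \<subseteq> V}"

definition mconst :: "'a::zero \<Rightarrow> ('v, 'a) mpoly" where
  "mconst a = Poly_Mapping.single 0 a"

definition mvar :: "'v \<Rightarrow> ('v, 'a::zero_neq_one) mpoly" where
  "mvar v = Poly_Mapping.single (Poly_Mapping.single v 1) 1"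

definition mdegree :: "('v \<Rightarrow>\<^sub>0 nat) \<Rightarrow> nat" where
  "mdegree \<alpha> = (\<Sum>v\<in>Poly_Mapping.keys \<alpha>. Poly_Mapping.lookup \<alpha> v)"

definition homogeneous :: "nat \<Rightarrow> ('v, 'a::zero) mpoly \<Rightarrow> bool" where
  "homogeneous d p \<longleftrightarrow> (\<forall>\<alpha>\<in>Poly_Mapping.keys p. mdegree \<alpha> = d)"

definition graded_ideal :: "('v, 'a::zero) mpoly set \<Rightarrow> ('v, 'a) mpoly ring \<Rightarrow> bool" where
  "graded_ideal I R \<longleftrightarrow> ideal I R \<and> I = Idl\<^bsub>R\<^esub> {p \<in> I. \<exists>d. homogeneous d p}"

section \<open>Rees algebra, symmetric algebra and conductor\<close>

text \<open>Throughout, \<open>A\<close> is (the carrier of) a ring and the list \<open>fs = [f\<^sub>0, \<dots>, f\<^sub>m\<^sub>-\<^sub>1]\<close> consists of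
  generators of the ideal \<open>I\<close> under consideration; the variables \<open>y\<^sub>0, \<dots>, y\<^sub>m\<^sub>-\<^sub>1\<close> are indexed
  from \<open>0\<close>.\<close>

text \<open>\<open>A[f\<^sub>0 t, \<dots>, f\<^sub>m\<^sub>-\<^sub>1 t]\<close>, the subring of the univariate polynomials generated by the constants
  from \<open>A\<close> and the elements \<open>f\<^sub>i t\<close>.\<close>

definition rees_algebra :: "'a::comm_ring_1 set \<Rightarrow> 'a list \<Rightarrow> 'a poly ring" where
  "rees_algebra A fs = subring_of
    (generate_ring (subring_of UNIV) ((\<lambda>a. [:a:]) ` A \<union> (\<lambda>f. monom f 1) ` set fs))"

definition rees_source :: "'a::comm_ring_1 set \<Rightarrow> 'a list \<Rightarrow> (nat, 'a) mpoly ring" where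
  "rees_source A fs = mpoly_ring A {..<length fs}"

text \<open>The substitution homomorphism \<open>\<phi>\<close> with \<open>y\<^sub>j \<mapsto> f\<^sub>j t\<close>.\<close>

definition rees_map :: "'a::comm_ring_1 list \<Rightarrow> (nat, 'a) mpoly \<Rightarrow> 'a poly" where
  "rees_map fs p = (\<Sum>\<alpha>\<in>Poly_Mapping.keys p. [:Poly_Mapping.lookup p \<alpha>:] *
      (\<Prod>j\<in>Poly_Mapping.keys \<alpha>. monom (fs ! j) 1 ^ Poly_Mapping.lookup \<alpha> j))"

definition rees_ideal :: "'a::comm_ring_1 set \<Rightarrow> 'a list \<Rightarrow> (nat, 'a) mpoly set" where
  "rees_ideal A fs = a_kernel (rees_source A fs) (rees_algebra A fs) (rees_map fs)"

definition linear_relations_ideal :: "'a::comm_ring_1 set \<Rightarrow> 'a list \<Rightarrow> (nat, 'a) mpoly set" where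
  "linear_relations_ideal A fs = Idl\<^bsub>rees_source A fs\<^esub>
    {\<Sum>i<length fs. mconst (a i) * mvar i | a.
      (\<forall>i<length fs. a i \<in> A) \<and> (\<Sum>i<length fs. a i * fs ! i) = 0}"

definition sym_algebra :: "'a::comm_ring_1 set \<Rightarrow> 'a list \<Rightarrow> (nat, 'a) mpoly set ring" where
  "sym_algebra A fs = rees_source A fs Quot linear_relations_ideal A fs"

definition conductor :: "'a::comm_ring_1 set \<Rightarrow> 'a list \<Rightarrow> 'a set" where
  "conductor A fs =
    {r \<in> A. \<forall>p\<in>rees_ideal A fs. mconst r * p \<in> linear_relations_ideal A fs}"

end

theory Submission
  imports Defs
begin

text \<open>A prime of \<open>T\<close> containing \<open>L\<close> contains \<open>J\<close> or the conductor, hence \<open>J\<close> or the variables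
  \<open>x\<^sub>0, \<dots>, x\<^sub>n\<^sub>-\<^sub>1\<close>. So \<open>dim S(I)\<close> is the maximum of \<open>dim \<R>(I) = n + 1\<close> and the dimension of the
  fibre \<open>S(I) / \<mm>S(I)\<close>, which is the symmetric algebra of the \<open>K\<close>-space \<open>I / \<mm>I\<close>, a polynomial
  ring in \<open>\<mu>(I)\<close> variables by the graded Nakayama lemma.

  Lower bounds for dimensions come from explicit chains of kernels of substitutions. For the upper
  bounds, elements \<open>x\<^sub>i \<in> P\<^sub>i\<^sub>+\<^sub>1 - P\<^sub>i\<close> of a chain of primes are algebraically independent modulo
  \<open>P\<^sub>0\<close> over \<open>K\<close>, while counting monomials shows that more than \<open>N\<close> elements of an algebra with \<open>N\<close>
  generators are dependent.\<close>

section \<open>Subrings, ideals and chains of primes\<close>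

text \<open>Both dimensions become explicit numbers, \<open>Suc n\<close> and
  \<open>max (Suc n) dim_fibre\<close>, and the equivalence is the comparison of the two. The value
  \<open>Suc n\<close> for the Rees algebra requires a nonzero generator, since the Rees algebra of
  the zero ideal is the polynomial ring itself. This comes from the conductor being proper: for the
  zero ideal J and L coincide, and the conductor would be the whole ring. Quotients would leave the
  polynomial types, so they are replaced by congruences: primes of S(I) are primes of T above L, and
  independence and generation are stated modulo the bottom prime of a chain. The given generators
  may be redundant, so the fibre is in general not a polynomial ring in all the \<open>y_i\<close>:
  some of them form a basis of I modulo \<mm>I, and the linear relations express the others through
  these.\<close>

locale csubring =
  fixes A :: "'a::comm_ring_1 set"
  assumes one_mem: "1 \<in> A"
    and diff_mem: "a \<in> A \<Longrightarrow> b \<in> A \<Longrightarrow> a - b \<in> A"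
    and mult_mem: "a \<in> A \<Longrightarrow> b \<in> A \<Longrightarrow> a * b \<in> A"
begin

lemma zero_mem: "0 \<in> A"
  using diff_mem[OF one_mem one_mem] by simp

lemma uminus_mem: "a \<in> A \<Longrightarrow> - a \<in> A"
  using diff_mem[OF zero_mem] by simp

lemma add_mem: "a \<in> A \<Longrightarrow> b \<in> A \<Longrightarrow> a + b \<in> A"
  using diff_mem[of a "- b"] uminus_mem by simp

lemma sum_mem: "(\<And>i. i \<in> F \<Longrightarrow> f i \<in> A) \<Longrightarrow> sum f F \<in> A"
  by (induction F rule: infinite_finite_induct) (auto simp: zero_mem add_mem)

lemma prod_mem: "(\<And>i. i \<in> F \<Longrightarrow> f i \<in> A) \<Longrightarrow> prod f F \<in> A"
  by (induction F rule: infinite_finite_induct) (auto simp: one_mem mult_mem)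

lemma power_mem: "a \<in> A \<Longrightarrow> a ^ k \<in> A"
  by (induction k) (auto simp: one_mem mult_mem)

end

text \<open>Ideals at the level of sets, so that computations use the operations of the type instead
  of those of a record. Negatives come from multiplication by -1, an element of every
  \<open>csubring\<close>.\<close>

definition ideal_in :: "'a::comm_ring_1 set \<Rightarrow> 'a set \<Rightarrow> bool" where
  "ideal_in A P \<longleftrightarrow> P \<subseteq> A \<and> 0 \<in> P \<and> (\<forall>a\<in>P. \<forall>b\<in>P. a + b \<in> P) \<and> (\<forall>a\<in>A. \<forall>b\<in>P. a * b \<in> P)"

definition prime_in :: "'a::comm_ring_1 set \<Rightarrow> 'a set \<Rightarrow> bool" where
  "prime_in A P \<longleftrightarrow> ideal_in A P \<and> 1 \<notin> P \<and> (\<forall>a\<in>A. \<forall>b\<in>A. a * b \<in> P \<longrightarrow> a \<in> P \<or> b \<in> P)"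

definition prime_chain :: "'a::comm_ring_1 set \<Rightarrow> (nat \<Rightarrow> 'a set) \<Rightarrow> nat \<Rightarrow> bool" where
  "prime_chain A P k \<longleftrightarrow> (\<forall>i\<le>k. prime_in A (P i)) \<and> (\<forall>i<k. P i \<subset> P (Suc i))"

lemma ideal_inD:
  assumes "ideal_in A P"
  shows "P \<subseteq> A" "0 \<in> P" "\<And>a b. a \<in> P \<Longrightarrow> b \<in> P \<Longrightarrow> a + b \<in> P"
    "\<And>a b. a \<in> A \<Longrightarrow> b \<in> P \<Longrightarrow> a * b \<in> P" "\<And>a b. b \<in> A \<Longrightarrow> a \<in> P \<Longrightarrow> a * b \<in> P"
  using assms unfolding ideal_in_def by (auto, metis mult.commute)

lemma ideal_in_sum:
  assumes "ideal_in A P" "\<And>i. i \<in> F \<Longrightarrow> f i \<in> P"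
  shows "sum f F \<in> P"
  using assms(2)
  by (induction F rule: infinite_finite_induct) (auto simp: ideal_inD[OF assms(1)])

lemma subring_of_simps [simp]:
  "carrier (subring_of A) = A" "monoid.mult (subring_of A) = (*)" "one (subring_of A) = 1"
  "ring.zero (subring_of A) = 0" "add (subring_of A) = (+)"
  by (simp_all add: subring_of_def)

context csubring
begin

lemma cring_subring_of: "cring (subring_of A)"
proof (rule cringI)
  show "abelian_group (subring_of A)"
  proof (rule abelian_groupI, goal_cases)
    case (6 x)
    then show ?case by (intro bexI[of _ "- x"]) (auto simp: uminus_mem)
  qed (auto simp: add_mem zero_mem ac_simps)
  show "comm_monoid (subring_of A)"
    by (rule comm_monoidI) (auto simp: one_mem mult_mem ac_simps)
qed (auto simp: algebra_simps)

lemma ring_subring_of: "ring (subring_of A)"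
  using cring_subring_of by (rule cring.axioms)

lemma a_inv_subring_of:
  assumes "a \<in> A"
  shows "\<ominus>\<^bsub>subring_of A\<^esub> a = - a"
proof -
  interpret cring "subring_of A" by (rule cring_subring_of)
  show ?thesis
    using minus_equality[of "- a" a] assms uminus_mem by simp
qed

lemma pow_subring_of: "a [^]\<^bsub>subring_of A\<^esub> (k::nat) = a ^ k"
proof -
  interpret cring "subring_of A" by (rule cring_subring_of)
  show ?thesis
    by (induction k) (auto simp: mult.commute)
qed

lemma ideal_in_uminus:
  assumes "ideal_in A P" "a \<in> P"
  shows "- a \<in> P"
  using ideal_inD(4)[OF assms(1) uminus_mem[OF one_mem] assms(2)] by simp

lemma ideal_in_diff:
  assumes "ideal_in A P" "a \<in> P" "b \<in> P"
  shows "a - b \<in> P"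
  using ideal_inD(3)[OF assms(1,2) ideal_in_uminus[OF assms(1,3)]] by simp

lemma ideal_subring_of_iff: "ideal P (subring_of A) \<longleftrightarrow> ideal_in A P"
proof
  assume "ideal P (subring_of A)"
  then interpret ideal P "subring_of A" .
  show "ideal_in A P"
    unfolding ideal_in_def
    using a_subset additive_subgroup.zero_closed[OF is_additive_subgroup]
      additive_subgroup.a_closed[OF is_additive_subgroup] I_l_closed by auto
next
  assume P: "ideal_in A P"
  interpret cring "subring_of A" by (rule cring_subring_of)
  show "ideal P (subring_of A)"
  proof (rule idealI)
    show "ring (subring_of A)" by (rule ring_subring_of)
    show "subgroup P (add_monoid (subring_of A))"
    proof (rule add.subgroupI)
      fix a assume "a \<in> P"
      then show "\<ominus>\<^bsub>subring_of A\<^esub> a \<in> P"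
        using ideal_inD(1)[OF P] a_inv_subring_of[of a] ideal_in_uminus[OF P] by auto
    qed (use ideal_inD[OF P] in auto)
  qed (use ideal_inD[OF P] in auto)
qed

lemma primeideal_subring_of_iff: "primeideal P (subring_of A) \<longleftrightarrow> prime_in A P"
proof
  assume "primeideal P (subring_of A)"
  then interpret primeideal P "subring_of A" .
  have "ideal_in A P" using is_ideal ideal_subring_of_iff by simp
  moreover have "1 \<notin> P"
    using I_notcarr one_imp_carrier by auto
  ultimately show "prime_in A P"
    unfolding prime_in_def using I_prime by auto
next
  assume P: "prime_in A P"
  show "primeideal P (subring_of A)"
    using P cring_subring_of one_mem
    by (intro primeidealI) (auto simp: prime_in_def ideal_subring_of_iff)
qed

section \<open>Krull dimension as a supremum over chains of primes in a fixed type\<close>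

lemma krull_dim_subring_of:
  "krull_dim (subring_of A) = (SUP k \<in> {k. \<exists>P. prime_chain A P k}. ereal (real k))"
  unfolding krull_dim_def primeideal_subring_of_iff prime_chain_def ..

text \<open>Preimage and image under the projection \<open>h\<close> carry primes of the quotient to
  primes above L and back, and both keep inclusions strict. Since chains increase, only the bottom
  prime has to be tested against L.\<close>

lemma krull_dim_quot:
  assumes L: "ideal_in A L"
  shows "krull_dim (subring_of A Quot L) =
    (SUP k \<in> {k. \<exists>P. prime_chain A P k \<and> L \<subseteq> P 0}. ereal (real k))"
proof -
  let ?R = "subring_of A"
  interpret ideal L ?R using L by (simp add: ideal_subring_of_iff)
  interpret Q: cring "?R Quot L" using quotient_is_cring[OF cring_subring_of] .
  define h where "h = (\<lambda>a. L +>\<^bsub>?R\<^esub> a)"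
  have hom: "h \<in> ring_hom ?R (?R Quot L)" unfolding h_def by (rule rcos_ring_hom)
  have h_add: "h (a + b) = h a \<oplus>\<^bsub>?R Quot L\<^esub> h b" if "a \<in> A" "b \<in> A" for a b
    using ring_hom_add[OF hom] that by simp
  have h_mult: "h (a * b) = h a \<otimes>\<^bsub>?R Quot L\<^esub> h b" if "a \<in> A" "b \<in> A" for a b
    using ring_hom_mult[OF hom] that by simp
  have h_one: "h 1 = \<one>\<^bsub>?R Quot L\<^esub>"
    using ring_hom_one[OF hom] by simp
  have h_zero: "h 0 = \<zero>\<^bsub>?R Quot L\<^esub>"
    using ring_hom_zero[OF hom ring_subring_of Q.ring_axioms] by simp
  have carr: "carrier (?R Quot L) = h ` A"
    unfolding FactRing_def A_RCOSETS_def' h_def by auto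
  have h_eq: "a - b \<in> L" if "a \<in> A" "b \<in> A" "h a = h b" for a b
  proof -
    have "a \<in> L +>\<^bsub>?R\<^esub> b" using that a_rcos_self[of a] by (simp add: h_def)
    then obtain l where "l \<in> L" "a = l + b" by (auto simp: a_r_coset_def')
    then show ?thesis by simp
  qed
  have h_L: "h a = \<zero>\<^bsub>?R Quot L\<^esub>" if "a \<in> L" for a
    using a_coset_join2[of a] that a_subgroup L ideal_inD(1)[OF L]
    by (auto simp: h_def FactRing_def)
  let ?pre = "\<lambda>Q. {a \<in> A. h a \<in> Q}"
  have pre: "prime_in A (?pre Q) \<and> L \<subseteq> ?pre Q" if Q: "primeideal Q (?R Quot L)" for Q
  proof -
    interpret primeideal Q "?R Quot L" by fact
    have "\<one>\<^bsub>?R Quot L\<^esub> \<notin> Q" using I_notcarr one_imp_carrier by auto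
    then show ?thesis unfolding prime_in_def ideal_in_def
      using h_add h_mult h_one h_zero h_L additive_subgroup.zero_closed[OF is_additive_subgroup]
        additive_subgroup.a_closed[OF is_additive_subgroup] I_l_closed I_prime carr
        zero_mem add_mem mult_mem ideal_inD(1)[OF L]
      by auto
  qed
  have image: "primeideal (h ` P) (?R Quot L)" and mem: "\<And>a. a \<in> A \<Longrightarrow> h a \<in> h ` P \<Longrightarrow> a \<in> P"
    if P: "prime_in A P" "L \<subseteq> P" for P
  proof -
    have I: "ideal_in A P" using P by (simp add: prime_in_def)
    \<comment> \<open>Elements with the same class differ by an element of L, hence of P, so
      membership in P can be read off the image.\<close>
    show mem: "a \<in> P" if "a \<in> A" "h a \<in> h ` P" for a
    proof -
      from that obtain b where b: "b \<in> P" "h a = h b" by auto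
      then have ab: "a - b \<in> P" using h_eq[of a b] that ideal_inD(1)[OF I] P by auto
      show ?thesis using ideal_inD(3)[OF I ab b(1)] by simp
    qed
    show "primeideal (h ` P) (?R Quot L)"
    proof (rule primeidealI)
      show "ideal (h ` P) (?R Quot L)"
        unfolding h_def
        by (rule ring.ring_ideal_imp_quot_ideal[OF ring_subring_of is_ideal])
          (use I in \<open>simp add: ideal_subring_of_iff\<close>)
      show "cring (?R Quot L)" ..
      have "1 \<notin> P" using P by (simp add: prime_in_def)
      then show "carrier (?R Quot L) \<noteq> h ` P"
        using mem[of 1] one_mem carr by (metis imageI)
      show "a \<in> h ` P \<or> b \<in> h ` P"
        if "a \<in> carrier (?R Quot L)" "b \<in> carrier (?R Quot L)" "a \<otimes>\<^bsub>?R Quot L\<^esub> b \<in> h ` P" for a b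
      proof -
        from that carr obtain a' b' where ab: "a' \<in> A" "b' \<in> A" "a = h a'" "b = h b'" by auto
        then have "a' * b' \<in> P" using that mem[of "a' * b'"] h_mult mult_mem by auto
        then have "a' \<in> P \<or> b' \<in> P" using P ab by (simp add: prime_in_def)
        then show ?thesis using ab by blast
      qed
    qed
  qed
  have "(\<exists>Q. (\<forall>i\<le>k. primeideal (Q i) (?R Quot L)) \<and> (\<forall>i<k. Q i \<subset> Q (Suc i)))
      \<longleftrightarrow> (\<exists>P. prime_chain A P k \<and> L \<subseteq> P 0)" (is "?l = ?r") for k
  proof
    assume ?l
    then obtain Q where Q: "\<And>i. i \<le> k \<Longrightarrow> primeideal (Q i) (?R Quot L)" "\<And>i. i < k \<Longrightarrow> Q i \<subset> Q (Suc i)"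
      by auto
    have "?pre (Q i) \<subset> ?pre (Q (Suc i))" if "i < k" for i
    proof -
      from Q(2)[OF that] obtain q where q: "q \<in> Q (Suc i)" "q \<notin> Q i" by auto
      have "Q (Suc i) \<subseteq> carrier (?R Quot L)"
        using Q(1)[of "Suc i"] that primeideal.axioms(1) additive_subgroup.a_subset ideal.axioms(1) by fastforce
      then obtain a where "a \<in> A" "q = h a" using q carr by auto
      then show ?thesis using q Q(2)[OF that] by auto
    qed
    then show ?r
      using pre Q(1) by (intro exI[of _ "\<lambda>i. ?pre (Q i)"]) (auto simp: prime_chain_def)
  next
    assume ?r
    then obtain P where P: "prime_chain A P k" "L \<subseteq> P 0" by auto
    have "L \<subseteq> P i" if "i \<le> k" for i
      using that
    proof (induction i)
      case (Suc i)
      then have "P i \<subset> P (Suc i)" using P by (simp add: prime_chain_def)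
      then show ?case using Suc by auto
    qed (use P in simp)
    then have PL: "prime_in A (P i)" "L \<subseteq> P i" if "i \<le> k" for i
      using that P by (auto simp: prime_chain_def)
    have "h ` P i \<subset> h ` P (Suc i)" if "i < k" for i
    proof -
      have s: "P i \<subset> P (Suc i)" using P that by (simp add: prime_chain_def)
      then obtain a where a: "a \<in> P (Suc i)" "a \<notin> P i" by auto
      have "a \<in> A" using PL(1)[of "Suc i"] that a by (auto simp: prime_in_def ideal_in_def)
      then have "h a \<notin> h ` P i" using mem[of "P i" a] PL[of i] that a by auto
      then show ?thesis using a s by auto
    qed
    then show ?l using image PL by (intro exI[of _ "\<lambda>i. h ` P i"]) auto
  qed
  then show ?thesis unfolding krull_dim_def by simp
qed

end

lemma SUP_nat_eq_ereal:
  assumes "m \<in> S" "\<And>k. k \<in> S \<Longrightarrow> k \<le> m"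
  shows "(SUP k \<in> S. ereal (real k)) = ereal (real m)"
  using assms by (intro antisym SUP_least SUP_upper) auto

lemma genideal_subring_of:
  assumes "csubring A" "S \<subseteq> A"
  shows "ideal_in A (Idl\<^bsub>subring_of A\<^esub> S)" "S \<subseteq> Idl\<^bsub>subring_of A\<^esub> S"
    "\<And>P. ideal_in A P \<Longrightarrow> S \<subseteq> P \<Longrightarrow> Idl\<^bsub>subring_of A\<^esub> S \<subseteq> P"
proof -
  interpret csubring A by fact
  interpret cring "subring_of A" by (rule cring_subring_of)
  show "ideal_in A (Idl\<^bsub>subring_of A\<^esub> S)"
    using genideal_ideal[of S] assms by (simp add: ideal_subring_of_iff)
  show "S \<subseteq> Idl\<^bsub>subring_of A\<^esub> S" using genideal_self[of S] assms by simp
  show "Idl\<^bsub>subring_of A\<^esub> S \<subseteq> P" if "ideal_in A P" "S \<subseteq> P" for P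
    using genideal_minimal[of P S] that by (simp add: ideal_subring_of_iff)
qed

text \<open>Homomorphisms are total on the types; where a subring matters, the kernel or image is
  intersected with its carrier.\<close>

locale rhom =
  fixes h :: "'a::comm_ring_1 \<Rightarrow> 'b::comm_ring_1"
  assumes hom_one: "h 1 = 1"
    and hom_add: "h (a + b) = h a + h b"
    and hom_mult: "h (a * b) = h a * h b"
begin

lemma hom_zero: "h 0 = 0"
  using hom_add[of 0 0] by simp

lemma hom_uminus: "h (- a) = - h a"
  using hom_add[of a "- a"] by (simp add: hom_zero add_eq_0_iff)

lemma hom_diff: "h (a - b) = h a - h b"
  using hom_add[of a "- b"] by (simp add: hom_uminus)

lemma hom_sum: "h (sum f F) = (\<Sum>i\<in>F. h (f i))"
  by (induction F rule: infinite_finite_induct) (auto simp: hom_zero hom_add)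

lemma hom_prod: "h (prod f F) = (\<Prod>i\<in>F. h (f i))"
  by (induction F rule: infinite_finite_induct) (auto simp: hom_one hom_mult)

lemma hom_power: "h (a ^ k) = h a ^ k"
  by (induction k) (auto simp: hom_one hom_mult)

end

lemma rhom_compose: "rhom g \<Longrightarrow> rhom h \<Longrightarrow> rhom (\<lambda>a. g (h a))"
  by (simp add: rhom_def)

lemma rhom_id: "rhom (\<lambda>a. a)"
  by (simp add: rhom_def)

text \<open>The image lies in a domain. Every explicit prime constructed below is such a
  kernel.\<close>

lemma (in csubring) prime_in_kernel:
  fixes h :: "'a \<Rightarrow> 'b::idom"
  assumes "rhom h"
  shows "prime_in A {a \<in> A. h a = 0}"
proof -
  interpret rhom h by fact
  show ?thesis
    unfolding prime_in_def ideal_in_def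
    by (auto simp: hom_zero hom_add hom_mult hom_one zero_mem add_mem mult_mem)
qed

lemma prime_in_power:
  assumes "prime_in A P" "x \<in> A" "x ^ k \<in> P" "csubring A"
  shows "x \<in> P"
  using assms(3)
proof (induction k)
  case (Suc k)
  then show ?case using assms csubring.power_mem[OF assms(4,2), of k]
    by (auto simp: prime_in_def)
qed (use assms in \<open>simp add: prime_in_def\<close>)

lemma prime_chain_mono:
  assumes "prime_chain A P k" "i \<le> j" "j \<le> k"
  shows "P i \<subseteq> P j"
  using assms(2,3)
proof (induction j rule: dec_induct)
  case (step m)
  then have "P m \<subset> P (Suc m)" using assms(1) by (simp add: prime_chain_def)
  then show ?case using step by auto
qed simp

section \<open>Algebraic independence along a chain of primes\<close>

text \<open>Among the terms of the relation keep those with the least exponent of \<open>x\<^sub>0\<close>, divide by that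
  power of \<open>x\<^sub>0\<close>, which is not in \<open>P\<^sub>0\<close>, and reduce modulo \<open>x\<^sub>0 \<in> P\<^sub>1\<close>; iterating over the
  variables leaves one nonzero constant in \<open>P\<^sub>k\<close>.\<close>

lemma prime_chain_independent:
  fixes \<kappa> :: "'k::field \<Rightarrow> 'a::comm_ring_1"
  assumes A: "csubring A" and \<kappa>: "rhom \<kappa>" "range \<kappa> \<subseteq> A"
    and P: "prime_chain A P k"
    and x: "\<And>i. i < k \<Longrightarrow> x i \<in> P (Suc i) - P i"
    and F: "finite F" "F \<subseteq> {..<k} \<rightarrow>\<^sub>E UNIV"
    and rel: "(\<Sum>\<alpha>\<in>F. \<kappa> (c \<alpha>) * (\<Prod>i<k. x i ^ \<alpha> i)) \<in> P 0"
    and \<alpha>: "\<alpha> \<in> F"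
  shows "c \<alpha> = 0"
proof (rule ccontr)
  assume "c \<alpha> \<noteq> 0"
  interpret csubring A by fact
  interpret rhom \<kappa> by fact
  have prime: "prime_in A (P j)" "ideal_in A (P j)" if "j \<le> k" for j
    using P that by (auto simp: prime_chain_def prime_in_def)
  have xA: "x i \<in> A" if "i < k" for i
    using x[OF that] ideal_inD(1)[OF prime(2)[of "Suc i"]] that by auto
  have \<kappa>A: "\<kappa> a \<in> A" for a using \<kappa> by auto
  \<comment> \<open>Invariant of the reduction: the surviving exponent vectors agree below
    \<open>j\<close>, and the terms, stripped of the variables below \<open>j\<close>, still sum to
    an element of \<open>P j\<close>. All surviving coefficients are nonzero.\<close>
  have "\<exists>G \<subseteq> {\<alpha>\<in>F. c \<alpha> \<noteq> 0}. G \<noteq> {} \<and> (\<forall>\<alpha>\<in>G. \<forall>\<beta>\<in>G. \<forall>i<j. \<alpha> i = \<beta> i) \<and>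
      (\<Sum>\<alpha>\<in>G. \<kappa> (c \<alpha>) * (\<Prod>i=j..<k. x i ^ \<alpha> i)) \<in> P j" if "j \<le> k" for j
    using that
  proof (induction j)
    case 0
    have "(\<Sum>\<alpha>\<in>{\<alpha>\<in>F. c \<alpha> \<noteq> 0}. \<kappa> (c \<alpha>) * (\<Prod>i=0..<k. x i ^ \<alpha> i)) =
        (\<Sum>\<alpha>\<in>F. \<kappa> (c \<alpha>) * (\<Prod>i<k. x i ^ \<alpha> i))"
      using F(1) by (intro sum.mono_neutral_cong_left) (auto simp: hom_zero atLeast0LessThan)
    then show ?case using rel \<alpha> \<open>c \<alpha> \<noteq> 0\<close>
      by (intro exI[of _ "{\<alpha>\<in>F. c \<alpha> \<noteq> 0}"]) auto
  next
    case (Suc j)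
    then obtain G where G: "G \<subseteq> {\<alpha>\<in>F. c \<alpha> \<noteq> 0}" "G \<noteq> {}"
      "\<forall>\<alpha>\<in>G. \<forall>\<beta>\<in>G. \<forall>i<j. \<alpha> i = \<beta> i"
      "(\<Sum>\<alpha>\<in>G. \<kappa> (c \<alpha>) * (\<Prod>i=j..<k. x i ^ \<alpha> i)) \<in> P j"
      by (meson Suc_leD)
    have finG: "finite G" using G(1) F(1) finite_subset by fastforce
    define m where "m = Min ((\<lambda>\<alpha>. \<alpha> j) ` G)"
    have m: "m \<le> \<alpha> j" if "\<alpha> \<in> G" for \<alpha>
      unfolding m_def using that finG by auto
    define G' where "G' = {\<alpha>\<in>G. \<alpha> j = m}"
    have "m \<in> (\<lambda>\<alpha>. \<alpha> j) ` G" unfolding m_def using finG G(2) by (intro Min_in) auto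
    then have "G' \<noteq> {}" by (auto simp: G'_def)
    define r where "r = (\<lambda>\<alpha>. \<kappa> (c \<alpha>) * (\<Prod>i=Suc j..<k. x i ^ \<alpha> i))"
    have rA: "r \<alpha> \<in> A" for \<alpha>
      unfolding r_def using xA by (intro mult_mem prod_mem power_mem \<kappa>A) auto
    define s where "s = (\<Sum>\<alpha>\<in>G. r \<alpha> * x j ^ (\<alpha> j - m))"
    have "(\<Sum>\<alpha>\<in>G. \<kappa> (c \<alpha>) * (\<Prod>i=j..<k. x i ^ \<alpha> i)) = x j ^ m * s"
      unfolding s_def r_def sum_distrib_left
    proof (rule sum.cong[OF refl])
      fix \<alpha> assume "\<alpha> \<in> G"
      have "x j ^ \<alpha> j = x j ^ m * x j ^ (\<alpha> j - m)"
        using m[OF \<open>\<alpha> \<in> G\<close>] by (simp flip: power_add)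
      moreover have "(\<Prod>i=j..<k. x i ^ \<alpha> i) = x j ^ \<alpha> j * (\<Prod>i=Suc j..<k. x i ^ \<alpha> i)"
        using Suc.prems by (intro prod.atLeast_Suc_lessThan) auto
      ultimately show "\<kappa> (c \<alpha>) * (\<Prod>i=j..<k. x i ^ \<alpha> i) =
          x j ^ m * (\<kappa> (c \<alpha>) * (\<Prod>i=Suc j..<k. x i ^ \<alpha> i) * x j ^ (\<alpha> j - m))"
        by (simp add: ac_simps)
    qed
    moreover have "x j ^ m \<notin> P j"
      using prime_in_power[OF prime(1) xA _ A, of j j m] x[of j] Suc.prems by auto
    moreover have sA: "s \<in> A" "x j ^ m \<in> A"
      unfolding s_def using xA[of j] Suc.prems by (auto intro!: sum_mem mult_mem power_mem rA)
    ultimately have "s \<in> P j" using G(4) prime(1)[of j] Suc.prems by (auto simp: prime_in_def)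
    then have sP: "s \<in> P (Suc j)" using prime_chain_mono[OF P, of j "Suc j"] Suc.prems by auto
    have xP: "x j \<in> P (Suc j)" using x[of j] Suc.prems by auto
    have I: "ideal_in A (P (Suc j))" using prime Suc.prems by auto
    \<comment> \<open>\<open>s\<close> is the relation after division by \<open>x j ^ m\<close>. Its
      terms outside \<open>G'\<close> keep a factor \<open>x j\<close>, which lies in
      \<open>P (Suc j)\<close>.\<close>
    have "s = (\<Sum>\<alpha>\<in>G'. r \<alpha> * x j ^ (\<alpha> j - m)) + (\<Sum>\<alpha>\<in>G-G'. r \<alpha> * x j ^ (\<alpha> j - m))"
      unfolding s_def using finG by (subst sum.subset_diff[of G']) (auto simp: G'_def add.commute)
    also have "(\<Sum>\<alpha>\<in>G'. r \<alpha> * x j ^ (\<alpha> j - m)) = (\<Sum>\<alpha>\<in>G'. r \<alpha>)"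
      by (rule sum.cong) (auto simp: G'_def)
    finally have "(\<Sum>\<alpha>\<in>G'. r \<alpha>) = s - (\<Sum>\<alpha>\<in>G-G'. r \<alpha> * x j ^ (\<alpha> j - m))"
      by simp
    moreover have "r \<alpha> * x j ^ (\<alpha> j - m) \<in> P (Suc j)" if "\<alpha> \<in> G - G'" for \<alpha>
    proof -
      have "m < \<alpha> j" using m[of \<alpha>] that by (auto simp: G'_def)
      then obtain l where l: "\<alpha> j - m = Suc l" by (metis Suc_diff_Suc)
      have "x j ^ l \<in> A" using xA[of j] Suc.prems by (auto intro: power_mem)
      then have "(r \<alpha> * x j ^ l) * x j \<in> P (Suc j)"
        by (intro ideal_inD(4)[OF I] xP mult_mem rA)
      then show ?thesis using l by (simp add: ac_simps)
    qed
    ultimately have "(\<Sum>\<alpha>\<in>G'. r \<alpha>) \<in> P (Suc j)"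
      by (simp only: ideal_in_diff[OF I sP ideal_in_sum[OF I]])
    moreover have "\<alpha> i = \<beta> i" if "\<alpha> \<in> G'" "\<beta> \<in> G'" "i < Suc j" for \<alpha> \<beta> i
      using G(3) that by (cases "i = j") (auto simp: G'_def)
    moreover have "G' \<subseteq> {\<alpha>\<in>F. c \<alpha> \<noteq> 0}" using G(1) by (auto simp: G'_def)
    ultimately show ?case using \<open>G' \<noteq> {}\<close> unfolding r_def by (intro exI[of _ G']) auto
  qed
  from this[OF le_refl] obtain G where G: "G \<subseteq> {\<alpha>\<in>F. c \<alpha> \<noteq> 0}" "G \<noteq> {}"
    "\<forall>\<alpha>\<in>G. \<forall>\<beta>\<in>G. \<forall>i<k. \<alpha> i = \<beta> i" "(\<Sum>\<alpha>\<in>G. \<kappa> (c \<alpha>) * (\<Prod>i=k..<k. x i ^ \<alpha> i)) \<in> P k"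
    by meson
  then obtain \<beta> where \<beta>: "\<beta> \<in> G" by auto
  \<comment> \<open>Agreement on all \<open>k\<close> coordinates forces equality because the
    exponent vectors are extensional functions.\<close>
  have "G = {\<beta>}"
  proof -
    have "\<gamma> = \<beta>" if "\<gamma> \<in> G" for \<gamma>
    proof (rule PiE_ext)
      show "\<gamma> \<in> {..<k} \<rightarrow>\<^sub>E UNIV" "\<beta> \<in> {..<k} \<rightarrow>\<^sub>E UNIV"
        using G(1) F(2) that \<beta> by auto
      show "\<gamma> i = \<beta> i" if "i \<in> {..<k}" for i
        using G(3) \<beta> \<open>\<gamma> \<in> G\<close> that by simp
    qed
    then show ?thesis using \<beta> by blast
  qed
  then have "\<kappa> (c \<beta>) \<in> P k" using G(4) by simp
  \<comment> \<open>A nonzero constant is a unit, so \<open>P k\<close> would contain 1.\<close>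
  then have "\<kappa> (1 / c \<beta>) * \<kappa> (c \<beta>) \<in> P k"
    using ideal_inD(4)[OF prime(2)[of k]] \<kappa>A by auto
  moreover have "\<kappa> (1 / c \<beta>) * \<kappa> (c \<beta>) = 1"
    using \<beta> G(1) by (auto simp flip: hom_mult simp: hom_one)
  ultimately show False using prime(1)[of k] by (simp add: prime_in_def)
qed

section \<open>Finitely generated subalgebras, filtered by bounds on the exponents\<close>

definition box_span :: "('k::field \<Rightarrow> 'b::comm_ring_1) \<Rightarrow> (nat \<Rightarrow> 'b) \<Rightarrow> nat \<Rightarrow> nat \<Rightarrow> 'b set" where
  "box_span \<kappa> z N D = module.span (\<lambda>c b. \<kappa> c * b)
    ((\<lambda>\<beta>. \<Prod>j<N. z j ^ \<beta> j) ` ({..<N} \<rightarrow>\<^sub>E {..D}))"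

text \<open>The subalgebra generated by \<open>z 0, ..., z (N - 1)\<close>, as an increasing union
  in which finitely many elements always share a box. Exponents are bounded one by one rather than
  in total, so that a box is spanned by at most (D + 1)^N monomials.\<close>

definition adjoin :: "('k::field \<Rightarrow> 'b::comm_ring_1) \<Rightarrow> (nat \<Rightarrow> 'b) \<Rightarrow> nat \<Rightarrow> 'b set" where
  "adjoin \<kappa> z N = (\<Union>D. box_span \<kappa> z N D)"

locale field_rhom = rhom \<kappa> for \<kappa> :: "'k::field \<Rightarrow> 'b::comm_ring_1"
begin

sublocale vs: vector_space "\<lambda>c b. \<kappa> c * b"
  by unfold_locales (auto simp: algebra_simps hom_add hom_mult hom_one)

lemma span_mult:
  assumes "\<And>s t. s \<in> S \<Longrightarrow> t \<in> T \<Longrightarrow> s * t \<in> vs.span U"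
    and "a \<in> vs.span S" "b \<in> vs.span T"
  shows "a * b \<in> vs.span U"
  using assms(2)
proof (induction rule: vs.span_induct_alt)
  case (step c s a)
  have "s * b \<in> vs.span U"
    using assms(3)
  proof (induction rule: vs.span_induct_alt)
    case (step d t b')
    have "s * (\<kappa> d * t + b') = \<kappa> d * (s * t) + s * b'" by (simp add: algebra_simps)
    then show ?case using assms(1)[OF \<open>s \<in> S\<close> step(1)] step(2)
      by (auto intro: vs.span_add vs.span_scale)
  qed (simp add: vs.span_zero)
  moreover have "(\<kappa> c * s + a) * b = \<kappa> c * (s * b) + a * b" by (simp add: algebra_simps)
  ultimately show ?case using step by (auto intro: vs.span_add vs.span_scale)
qed (simp add: vs.span_zero)

lemma box_span_mono: "D \<le> E \<Longrightarrow> box_span \<kappa> z N D \<subseteq> box_span \<kappa> z N E"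
  unfolding box_span_def by (intro vs.span_mono image_mono PiE_mono) auto

lemma box_span_mult:
  assumes "a \<in> box_span \<kappa> z N D" "b \<in> box_span \<kappa> z N E"
  shows "a * b \<in> box_span \<kappa> z N (D + E)"
  using assms unfolding box_span_def
proof (rule span_mult[rotated])
  fix s t
  assume "s \<in> (\<lambda>\<beta>. \<Prod>j<N. z j ^ \<beta> j) ` ({..<N} \<rightarrow>\<^sub>E {..D})" "t \<in> (\<lambda>\<beta>. \<Prod>j<N. z j ^ \<beta> j) ` ({..<N} \<rightarrow>\<^sub>E {..E})"
  then obtain \<beta> \<gamma> where *: "\<beta> \<in> {..<N} \<rightarrow>\<^sub>E {..D}" "s = (\<Prod>j<N. z j ^ \<beta> j)"
    "\<gamma> \<in> {..<N} \<rightarrow>\<^sub>E {..E}" "t = (\<Prod>j<N. z j ^ \<gamma> j)" by auto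
  then have "s * t = (\<Prod>j<N. z j ^ restrict (\<lambda>j. \<beta> j + \<gamma> j) {..<N} j)"
    by (simp add: power_add prod.distrib)
  moreover have "restrict (\<lambda>j. \<beta> j + \<gamma> j) {..<N} \<in> {..<N} \<rightarrow>\<^sub>E {..D + E}"
    using * by (force simp: PiE_iff intro: add_mono)
  ultimately show "s * t \<in> vs.span ((\<lambda>\<beta>. \<Prod>j<N. z j ^ \<beta> j) ` ({..<N} \<rightarrow>\<^sub>E {..D + E}))"
    by (simp only:) (intro vs.span_base imageI)
qed

lemma box_span_one: "1 \<in> box_span \<kappa> z N D"
proof -
  have "(\<Prod>j<N. z j ^ restrict (\<lambda>_. 0) {..<N} j) \<in> box_span \<kappa> z N D"
    unfolding box_span_def by (intro vs.span_base imageI) (auto simp: PiE_iff extensional_def)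
  then show ?thesis by simp
qed

lemma box_span_const: "\<kappa> c \<in> box_span \<kappa> z N D"
  using vs.span_scale[OF box_span_one[unfolded box_span_def], of c z N D]
  by (simp add: box_span_def)

lemma box_span_var:
  assumes "i < N"
  shows "z i \<in> box_span \<kappa> z N 1"
proof -
  have "(\<Prod>j<N. z j ^ restrict (\<lambda>j. if j = i then 1 else 0) {..<N} j) \<in> box_span \<kappa> z N 1"
    unfolding box_span_def by (intro vs.span_base imageI) (auto simp: PiE_iff extensional_def)
  moreover have "(\<Prod>j<N. z j ^ restrict (\<lambda>j. if j = i then 1 else 0) {..<N} j) =
      (\<Prod>j<N. if j = i then z j else 1)"
    by (rule prod.cong) auto
  ultimately show ?thesis using assms by simp
qed

lemma box_span_power:
  assumes "a \<in> box_span \<kappa> z N D"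
  shows "a ^ k \<in> box_span \<kappa> z N (k * D)"
proof (induction k)
  case (Suc k)
  then show ?case using box_span_mult[OF assms Suc] by simp
qed (simp add: box_span_one)

lemma box_span_prod:
  assumes "\<And>i. i \<in> F \<Longrightarrow> a i \<in> box_span \<kappa> z N (D i)"
  shows "prod a F \<in> box_span \<kappa> z N (sum D F)"
  using assms
proof (induction F rule: infinite_finite_induct)
  case (insert x F)
  then show ?case using box_span_mult[of "a x" z N "D x" "prod a F" "sum D F"] by simp
qed (auto simp: box_span_one)

lemma adjoin_add:
  assumes "a \<in> adjoin \<kappa> z N" "b \<in> adjoin \<kappa> z N"
  shows "a + b \<in> adjoin \<kappa> z N"
proof -
  from assms obtain D E where "a \<in> box_span \<kappa> z N D" "b \<in> box_span \<kappa> z N E"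
    by (auto simp: adjoin_def)
  then have "a \<in> box_span \<kappa> z N (max D E)" "b \<in> box_span \<kappa> z N (max D E)"
    using box_span_mono[of D "max D E" z N] box_span_mono[of E "max D E" z N]
      max.cobounded1 max.cobounded2 by blast+
  then have "a + b \<in> box_span \<kappa> z N (max D E)"
    unfolding box_span_def by (rule vs.span_add)
  then show ?thesis by (auto simp: adjoin_def)
qed

lemma adjoin_mult: "a \<in> adjoin \<kappa> z N \<Longrightarrow> b \<in> adjoin \<kappa> z N \<Longrightarrow> a * b \<in> adjoin \<kappa> z N"
  using box_span_mult by (fastforce simp: adjoin_def)

lemma adjoin_const: "\<kappa> c \<in> adjoin \<kappa> z N"
  using box_span_const by (auto simp: adjoin_def)

lemma adjoin_var: "i < N \<Longrightarrow> z i \<in> adjoin \<kappa> z N"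
  using box_span_var by (auto simp: adjoin_def)

lemma csubring_adjoin: "csubring (adjoin \<kappa> z N)"
proof
  fix a b assume "a \<in> adjoin \<kappa> z N" "b \<in> adjoin \<kappa> z N"
  then show "a - b \<in> adjoin \<kappa> z N"
    using adjoin_add[OF _ adjoin_mult[OF adjoin_const[of "-1"]], of a z N b]
    by (simp add: hom_uminus hom_one)
qed (use adjoin_mult adjoin_const[of 1] in \<open>auto simp: hom_one\<close>)

text \<open>There are \<open>E\<^sup>N\<^sup>+\<^sup>1\<close> monomials in \<open>u\<^sub>0, \<dots>, u\<^sub>N\<close> with exponents below \<open>E\<close>, and they lie in a space
  whose dimension is at most a constant times \<open>E\<^sup>N\<close>.\<close>

lemma algebraic_relation:
  assumes "\<And>i. i < Suc N \<Longrightarrow> u i \<in> adjoin \<kappa> z N"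
  obtains F c where "finite F" "F \<subseteq> {..<Suc N} \<rightarrow>\<^sub>E UNIV" "\<exists>\<alpha>\<in>F. c \<alpha> \<noteq> 0"
    "(\<Sum>\<alpha>\<in>F. \<kappa> (c \<alpha>) * (\<Prod>i<Suc N. u i ^ \<alpha> i)) = 0"
proof -
  have "\<forall>i. \<exists>D. i < Suc N \<longrightarrow> u i \<in> box_span \<kappa> z N D" using assms by (auto simp: adjoin_def)
  then obtain D' where D': "\<And>i. i < Suc N \<Longrightarrow> u i \<in> box_span \<kappa> z N (D' i)" by metis
  \<comment> \<open>A common box for all \<open>u i\<close>; the sum serves as a convenient upper
    bound for the maximum of the \<open>D' i\<close>.\<close>
  define D where "D = (\<Sum>i<Suc N. D' i)"
  have D: "u i \<in> box_span \<kappa> z N D" if "i < Suc N" for i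
    using box_span_mono[of "D' i" D z N] D'[OF that] member_le_sum[of i "{..<Suc N}" D'] that
    by (auto simp: D_def simp del: sum.lessThan_Suc)
  \<comment> \<open>Products of powers \<open>u i ^ \<alpha> i\<close> with exponents below E lie in
    the box of size M = (N + 1) E D, which has at most (M + 1)^N \<le> E^N ((N + 1) D + 1)^N
    monomials. This is less than E^(N + 1) as soon as E exceeds the second factor.\<close>
  define E where "E = Suc ((Suc N * D + 1) ^ N)"
  define M where "M = Suc N * (E * D)"
  define F where "F = ({..<Suc N} \<rightarrow>\<^sub>E {..<E})"
  define U where "U = (\<lambda>\<alpha>. \<Prod>i<Suc N. u i ^ \<alpha> i)"
  define T where "T = (\<lambda>\<beta>. \<Prod>j<N. z j ^ \<beta> j) ` ({..<N} \<rightarrow>\<^sub>E {..M})"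
  have fin: "finite F" "finite T" unfolding F_def T_def by (auto intro: finite_PiE)
  have "card T \<le> card ({..<N} \<rightarrow>\<^sub>E {..M})"
    unfolding T_def by (intro card_image_le finite_PiE) auto
  also have "\<dots> = Suc M ^ N" by (simp add: card_PiE)
  also have "\<dots> \<le> (E * (Suc N * D + 1)) ^ N"
    by (intro power_mono) (auto simp: M_def E_def algebra_simps)
  also have "\<dots> = E ^ N * (Suc N * D + 1) ^ N" by (rule power_mult_distrib)
  also have "\<dots> < E ^ N * E" by (simp add: E_def)
  also have "\<dots> = card F" by (simp add: F_def card_PiE)
  finally have less: "card T < card F" .
  have U_span: "U \<alpha> \<in> vs.span T" if "\<alpha> \<in> F" for \<alpha>
  proof -
    have "u i ^ \<alpha> i \<in> box_span \<kappa> z N (E * D)" if "i < Suc N" for i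
    proof -
      have "\<alpha> i \<le> E" using \<open>\<alpha> \<in> F\<close> that unfolding F_def by (meson PiE_mem lessThan_iff less_imp_le)
      then show ?thesis using box_span_power[OF D[OF that], of "\<alpha> i"] box_span_mono[of "\<alpha> i * D" "E * D"]
        by auto
    qed
    then have "U \<alpha> \<in> box_span \<kappa> z N (\<Sum>i<Suc N. E * D)"
      unfolding U_def by (intro box_span_prod) auto
    then show ?thesis by (simp add: box_span_def T_def M_def)
  qed
  \<comment> \<open>Linear dependence concerns the set of products, not the family. If two exponent
    vectors give the same product, that coincidence is already a relation, with coefficients 1 and
    -1.\<close>
  show ?thesis
  proof (cases "inj_on U F")
    case True
    have "vs.dependent (U ` F)"
    proof (rule ccontr)
      assume "\<not> vs.dependent (U ` F)"
      then have "card (U ` F) \<le> card T"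
        using vs.independent_span_bound[OF fin(2), of "U ` F"] U_span by auto
      then show False using less card_image[OF True] by simp
    qed
    then obtain c where c: "\<exists>v\<in>U ` F. c v \<noteq> 0" "(\<Sum>v\<in>U ` F. \<kappa> (c v) * v) = 0"
      using vs.dependent_finite[of "U ` F"] fin by auto
    show ?thesis
    proof (rule that[of F "\<lambda>\<alpha>. c (U \<alpha>)"])
      show "(\<Sum>\<alpha>\<in>F. \<kappa> (c (U \<alpha>)) * (\<Prod>i<Suc N. u i ^ \<alpha> i)) = 0"
        using c(2) unfolding sum.reindex[OF True] o_def by (simp only: U_def)
    qed (use fin c in \<open>auto simp: F_def\<close>)
  next
    case False
    then obtain \<alpha> \<beta> where *: "\<alpha> \<in> F" "\<beta> \<in> F" "U \<alpha> = U \<beta>" "\<alpha> \<noteq> \<beta>" by (auto simp: inj_on_def)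
    show ?thesis
    proof (rule that[of "{\<alpha>, \<beta>}" "\<lambda>\<gamma>. if \<gamma> = \<alpha> then 1 else - 1"])
      show "(\<Sum>\<gamma>\<in>{\<alpha>, \<beta>}. \<kappa> (if \<gamma> = \<alpha> then 1 else - 1) * (\<Prod>i<Suc N. u i ^ \<gamma> i)) = 0"
        using * by (auto simp: U_def hom_one hom_uminus simp del: prod.lessThan_Suc)
    qed (use * in \<open>auto simp: F_def\<close>)
  qed
qed

end

text \<open>Independence holds modulo \<open>P 0\<close> inside A, while monomials are counted in
  the target of \<open>h\<close>. A relation among images lifts because \<open>h\<close> vanishes on
  A only inside \<open>P 0\<close>, and generators are needed only up to \<open>P 0\<close>. The
  first freedom allows \<open>h = \<phi>\<close> for chains above J, the second serves the fibre,
  where \<open>h\<close> is the identity.\<close>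

lemma prime_chain_length_le:
  fixes \<kappa> :: "'k::field \<Rightarrow> 'a::comm_ring_1" and h :: "'a \<Rightarrow> 'b::comm_ring_1"
  assumes A: "csubring A" and \<kappa>: "rhom \<kappa>" "range \<kappa> \<subseteq> A"
    and P: "prime_chain A P k"
    and h: "rhom h" "\<And>a. a \<in> A \<Longrightarrow> h a = 0 \<Longrightarrow> a \<in> P 0"
    and gen: "\<And>a. a \<in> A \<Longrightarrow> \<exists>a'\<in>A. a - a' \<in> P 0 \<and> h a' \<in> adjoin (\<lambda>c. h (\<kappa> c)) z N"
  shows "k \<le> N"
proof (rule ccontr)
  assume "\<not> k \<le> N"
  then have Pk: "prime_chain A P (Suc N)" using P by (auto simp: prime_chain_def)
  interpret csubring A by fact
  interpret h: rhom h by fact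
  interpret field_rhom "\<lambda>c. h (\<kappa> c)"
    using rhom_compose[OF h(1) \<kappa>(1)] by (simp add: field_rhom_def)
  have prime: "ideal_in A (P i)" if "i \<le> Suc N" for i
    using that Pk by (auto simp: prime_chain_def prime_in_def)
  \<comment> \<open>A witness of the strict inclusion may be changed by an element of
    \<open>P 0\<close>, which lies in all members of the chain.\<close>
  have "\<exists>x\<in>A. x \<in> P (Suc i) - P i \<and> h x \<in> adjoin (\<lambda>c. h (\<kappa> c)) z N" if i: "i < Suc N" for i
  proof -
    have I: "ideal_in A (P i)" "ideal_in A (P (Suc i))" using i prime by auto
    have "P i \<subset> P (Suc i)" using i Pk by (simp add: prime_chain_def)
    then obtain y where y: "y \<in> P (Suc i)" "y \<notin> P i" by auto
    then have "y \<in> A" using ideal_inD(1)[OF I(2)] by auto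
    then obtain x where x: "x \<in> A" "y - x \<in> P 0" "h x \<in> adjoin (\<lambda>c. h (\<kappa> c)) z N" using gen by auto
    have "y - x \<in> P i" "y - x \<in> P (Suc i)"
      using x prime_chain_mono[OF Pk, of 0 i] prime_chain_mono[OF Pk, of 0 "Suc i"] i by auto
    then show ?thesis
      using x y ideal_inD(3)[OF I(1), of "y - x" x] ideal_in_diff[OF I(2), of y "y - x"] by auto
  qed
  then obtain x where x: "\<And>i. i < Suc N \<Longrightarrow> x i \<in> A \<and> x i \<in> P (Suc i) - P i \<and> h (x i) \<in> adjoin (\<lambda>c. h (\<kappa> c)) z N"
    by metis
  obtain F c where F: "finite F" "F \<subseteq> {..<Suc N} \<rightarrow>\<^sub>E UNIV"
    "\<exists>\<alpha>\<in>F. c \<alpha> \<noteq> 0" "(\<Sum>\<alpha>\<in>F. h (\<kappa> (c \<alpha>)) * (\<Prod>i<Suc N. h (x i) ^ \<alpha> i)) = 0"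
  proof (rule algebraic_relation[of N "\<lambda>i. h (x i)" z])
    show "h (x i) \<in> adjoin (\<lambda>c. h (\<kappa> c)) z N" if "i < Suc N" for i
      using x that by blast
  qed blast
  have "h (\<Sum>\<alpha>\<in>F. \<kappa> (c \<alpha>) * (\<Prod>i<Suc N. x i ^ \<alpha> i)) = 0"
    using F(4) by (simp only: h.hom_sum h.hom_mult h.hom_prod h.hom_power)
  moreover have "(\<Sum>\<alpha>\<in>F. \<kappa> (c \<alpha>) * (\<Prod>i<Suc N. x i ^ \<alpha> i)) \<in> A"
    using x \<kappa>(2) by (intro sum_mem mult_mem prod_mem power_mem) auto
  ultimately have "(\<Sum>\<alpha>\<in>F. \<kappa> (c \<alpha>) * (\<Prod>i<Suc N. x i ^ \<alpha> i)) \<in> P 0" using h(2) by blast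
  then have "\<forall>\<alpha>\<in>F. c \<alpha> = 0"
    using prime_chain_independent[OF A \<kappa> Pk _ F(1,2), of x c] x by blast
  then show False using F(3) by auto
qed

section \<open>Substitution in multivariate polynomials\<close>

definition mcarrier :: "'a::comm_ring_1 set \<Rightarrow> 'v set \<Rightarrow> ('v, 'a) mpoly set" where
  "mcarrier A V = {p. \<forall>\<alpha>\<in>Poly_Mapping.keys p. Poly_Mapping.lookup p \<alpha> \<in> A \<and> Poly_Mapping.keys \<alpha> \<subseteq> V}"

lemma mpoly_ring_eq: "mpoly_ring A V = subring_of (mcarrier A V)"
  by (simp add: mpoly_ring_def mcarrier_def)

lemma sum_single_keys:
  assumes "finite S" "Poly_Mapping.keys p \<subseteq> S"
  shows "(\<Sum>\<alpha>\<in>S. Poly_Mapping.single \<alpha> (Poly_Mapping.lookup p \<alpha>)) = (p :: _ \<Rightarrow>\<^sub>0 'a::comm_monoid_add)"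
proof (rule poly_mapping_eqI)
  fix \<beta>
  have "(\<Sum>\<alpha>\<in>S. Poly_Mapping.lookup p \<alpha> when \<alpha> = \<beta>) = (\<Sum>\<alpha>\<in>S \<inter> {\<beta>}. Poly_Mapping.lookup p \<alpha>)"
    using assms(1) by (intro sum.mono_neutral_cong_right) (auto simp: when_def)
  also have "\<dots> = Poly_Mapping.lookup p \<beta>"
    using assms(2) by (cases "\<beta> \<in> S") (auto simp: in_keys_iff)
  finally show "Poly_Mapping.lookup (\<Sum>\<alpha>\<in>S. Poly_Mapping.single \<alpha> (Poly_Mapping.lookup p \<alpha>)) \<beta> = Poly_Mapping.lookup p \<beta>"
    by (simp add: lookup_sum lookup_single)
qed

text \<open>Substitution with a change of coefficients. The map \<open>\<phi>\<close>, the constant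
  term, the reductions \<open>trunc\<close>, the grading and the map onto the fibre are all
  instances.\<close>

definition meval :: "('a::comm_ring_1 \<Rightarrow> 'b::comm_ring_1) \<Rightarrow> ('v \<Rightarrow> 'b) \<Rightarrow> ('v, 'a) mpoly \<Rightarrow> 'b" where
  "meval \<kappa> v p = (\<Sum>\<alpha>\<in>Poly_Mapping.keys p. \<kappa> (Poly_Mapping.lookup p \<alpha>) *
      (\<Prod>j\<in>Poly_Mapping.keys \<alpha>. v j ^ Poly_Mapping.lookup \<alpha> j))"

lemma prod_keys_superset:
  assumes "finite S" "Poly_Mapping.keys \<alpha> \<subseteq> S"
  shows "(\<Prod>j\<in>Poly_Mapping.keys \<alpha>. v j ^ Poly_Mapping.lookup \<alpha> j) = (\<Prod>j\<in>S. (v j :: 'b::comm_monoid_mult) ^ Poly_Mapping.lookup \<alpha> j)"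
  using assms by (intro prod.mono_neutral_left) (auto simp: in_keys_iff)

lemma prod_keys_add:
  "(\<Prod>j\<in>Poly_Mapping.keys (\<alpha> + \<beta>). (v j :: 'b::comm_monoid_mult) ^ Poly_Mapping.lookup (\<alpha> + \<beta>) j) =
    (\<Prod>j\<in>Poly_Mapping.keys \<alpha>. v j ^ Poly_Mapping.lookup \<alpha> j) *
    (\<Prod>j\<in>Poly_Mapping.keys \<beta>. v j ^ Poly_Mapping.lookup \<beta> j)"
proof -
  let ?S = "Poly_Mapping.keys \<alpha> \<union> Poly_Mapping.keys \<beta>"
  have "finite ?S" "Poly_Mapping.keys \<alpha> \<subseteq> ?S" "Poly_Mapping.keys \<beta> \<subseteq> ?S" by auto
  note superset = prod_keys_superset[OF this(1)]
  show ?thesis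
    unfolding superset[OF keys_add] superset[OF \<open>Poly_Mapping.keys \<alpha> \<subseteq> ?S\<close>]
      superset[OF \<open>Poly_Mapping.keys \<beta> \<subseteq> ?S\<close>]
    by (simp add: lookup_add power_add prod.distrib)
qed

context rhom
begin

lemma meval_superset:
  assumes "finite S" "Poly_Mapping.keys p \<subseteq> S"
  shows "meval h v p = (\<Sum>\<alpha>\<in>S. h (Poly_Mapping.lookup p \<alpha>) *
      (\<Prod>j\<in>Poly_Mapping.keys \<alpha>. v j ^ Poly_Mapping.lookup \<alpha> j))"
  unfolding meval_def using assms
  by (intro sum.mono_neutral_left) (auto simp: in_keys_iff hom_zero)

lemma meval_single:
  "meval h v (Poly_Mapping.single \<alpha> a) = h a * (\<Prod>j\<in>Poly_Mapping.keys \<alpha>. v j ^ Poly_Mapping.lookup \<alpha> j)"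
  by (subst meval_superset[of "{\<alpha>}"]) auto

lemma meval_add: "meval h v (p + q) = meval h v p + meval h v q"
proof -
  let ?S = "Poly_Mapping.keys p \<union> Poly_Mapping.keys q"
  show ?thesis
    using keys_add[of p q]
    by (simp add: meval_superset[of ?S] lookup_add hom_add algebra_simps sum.distrib)
qed

lemma meval_sum: "meval h v (sum f F) = (\<Sum>i\<in>F. meval h v (f i))"
proof -
  have "meval h v 0 = 0" by (simp add: meval_def)
  then show ?thesis
    by (induction F rule: infinite_finite_induct) (auto simp: meval_add)
qed

lemma meval_mult: "meval h v (p * q) = meval h v p * meval h v q"
proof -
  let ?s = "\<lambda>p \<alpha>. Poly_Mapping.single \<alpha> (Poly_Mapping.lookup p \<alpha>)"
  have single: "meval h v (?s p \<alpha> * ?s q \<beta>) = meval h v (?s p \<alpha>) * meval h v (?s q \<beta>)" for \<alpha> \<beta>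
    by (simp add: mult_single meval_single prod_keys_add hom_mult ac_simps)
  have "p * q = (\<Sum>\<alpha>\<in>Poly_Mapping.keys p. \<Sum>\<beta>\<in>Poly_Mapping.keys q. ?s p \<alpha> * ?s q \<beta>)"
    by (simp add: sum_single_keys flip: sum_product)
  then have "meval h v (p * q) = (\<Sum>\<alpha>\<in>Poly_Mapping.keys p. meval h v (?s p \<alpha>)) * (\<Sum>\<beta>\<in>Poly_Mapping.keys q. meval h v (?s q \<beta>))"
    by (simp add: meval_sum single sum_product)
  then show ?thesis
    by (simp add: sum_single_keys flip: meval_sum)
qed

lemma meval_mconst: "meval h v (mconst a) = h a"
  unfolding mconst_def by (simp add: meval_single)

lemma meval_mvar: "meval h v (mvar j) = v j"
  unfolding mvar_def by (simp add: meval_single hom_one)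

lemma rhom_meval: "rhom (meval h v)"
proof
  have "meval h v (mconst 1) = 1" by (simp add: meval_mconst hom_one)
  then show "meval h v 1 = 1" by (simp add: mconst_def)
qed (simp_all add: meval_add meval_mult)

lemma hom_meval: "h (meval \<kappa> v p) = meval (\<lambda>a. h (\<kappa> a)) (\<lambda>j. h (v j)) p"
  by (simp add: meval_def hom_sum hom_mult hom_prod hom_power)

end

lemma rhom_mconst: "rhom mconst"
  by unfold_locales (simp_all add: mconst_def single_add mult_single)

lemma single_eq_mconst_mvar:
  fixes a :: "'a::comm_ring_1" and \<alpha> :: "'v \<Rightarrow>\<^sub>0 nat"
  shows "Poly_Mapping.single \<alpha> a = mconst a * (\<Prod>j\<in>Poly_Mapping.keys \<alpha>. mvar j ^ Poly_Mapping.lookup \<alpha> j)"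
proof -
  have pow: "mvar j ^ k = Poly_Mapping.single (Poly_Mapping.single j k) (1::'a)" for j :: 'v and k
    by (induction k) (simp_all add: mvar_def mult_single flip: single_add)
  have prod: "(\<Prod>j\<in>S. Poly_Mapping.single (f j) (1::'a)) = Poly_Mapping.single (sum f S) 1"
    for S and f :: "'v \<Rightarrow> 'v \<Rightarrow>\<^sub>0 nat"
    by (induction S rule: infinite_finite_induct) (simp_all add: mult_single)
  show ?thesis
    by (simp add: pow prod sum_single_keys mconst_def mult_single)
qed

lemma meval_mconst_mvar: "meval mconst mvar p = p"
  by (simp add: meval_def sum_single_keys flip: single_eq_mconst_mvar)

lemma mcarrier_single: "a \<in> A \<Longrightarrow> Poly_Mapping.keys \<alpha> \<subseteq> V \<Longrightarrow> Poly_Mapping.single \<alpha> a \<in> mcarrier A V"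
  by (simp add: mcarrier_def)

lemma csubring_UNIV: "csubring UNIV"
  by unfold_locales auto

context csubring
begin

lemma lookup_mcarrier: "p \<in> mcarrier A V \<Longrightarrow> Poly_Mapping.lookup p \<alpha> \<in> A"
  by (cases "\<alpha> \<in> Poly_Mapping.keys p") (auto simp: mcarrier_def in_keys_iff zero_mem)

lemma mcarrier_diff:
  assumes "p \<in> mcarrier A V" "q \<in> mcarrier A V"
  shows "p - q \<in> mcarrier A V"
  unfolding mcarrier_def
proof safe
  fix \<alpha> assume \<alpha>: "\<alpha> \<in> Poly_Mapping.keys (p - q)"
  show "Poly_Mapping.lookup (p - q) \<alpha> \<in> A"
    using assms by (simp add: lookup_minus diff_mem lookup_mcarrier)
  fix x assume x: "x \<in> Poly_Mapping.keys \<alpha>"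
  have "\<alpha> \<in> Poly_Mapping.keys p \<or> \<alpha> \<in> Poly_Mapping.keys q"
    using \<alpha> by (auto simp: in_keys_iff lookup_minus)
  then show "x \<in> V" using x assms by (auto simp: mcarrier_def)
qed

lemma mcarrier_sum:
  assumes "\<And>i. i \<in> F \<Longrightarrow> f i \<in> mcarrier A V"
  shows "sum f F \<in> mcarrier A V"
proof -
  have z: "0 \<in> mcarrier A V" by (simp add: mcarrier_def)
  have "p + q \<in> mcarrier A V" if "p \<in> mcarrier A V" "q \<in> mcarrier A V" for p q
    using mcarrier_diff[OF that(1) mcarrier_diff[OF z that(2)]] by simp
  then show ?thesis using assms z
    by (induction F rule: infinite_finite_induct) auto
qed

lemma csubring_mcarrier: "csubring (mcarrier A V)"
proof
  show "1 \<in> mcarrier A V" using mcarrier_single[of 1 A 0 V] by (simp add: one_mem)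
  fix p q assume pq: "p \<in> mcarrier A V" "q \<in> mcarrier A V"
  show "p - q \<in> mcarrier A V" using pq by (rule mcarrier_diff)
  let ?s = "\<lambda>p \<alpha>. Poly_Mapping.single \<alpha> (Poly_Mapping.lookup p \<alpha>)"
  have "p * q = (\<Sum>\<alpha>\<in>Poly_Mapping.keys p. \<Sum>\<beta>\<in>Poly_Mapping.keys q. ?s p \<alpha> * ?s q \<beta>)"
    by (simp add: sum_single_keys flip: sum_product)
  moreover have "?s p \<alpha> * ?s q \<beta> \<in> mcarrier A V"
    if "\<alpha> \<in> Poly_Mapping.keys p" "\<beta> \<in> Poly_Mapping.keys q" for \<alpha> \<beta>
  proof -
    have "Poly_Mapping.keys (\<alpha> + \<beta>) \<subseteq> V"
      using that pq by (intro order.trans[OF keys_add]) (auto simp: mcarrier_def)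
    then show ?thesis using pq by (simp add: mult_single mcarrier_single mult_mem lookup_mcarrier)
  qed
  ultimately show "p * q \<in> mcarrier A V" by (auto intro!: mcarrier_sum)
qed

lemma mconst_mcarrier: "a \<in> A \<Longrightarrow> mconst a \<in> mcarrier A V"
  by (simp add: mconst_def mcarrier_single)

lemma mvar_mcarrier: "v \<in> V \<Longrightarrow> mvar v \<in> mcarrier A V"
  by (simp add: mvar_def mcarrier_single one_mem)

end

lemma mcarrier_induct [consumes 1, case_names const var add mult]:
  fixes A :: "'a::comm_ring_1 set" and V :: "'v set"
  assumes "p \<in> mcarrier A V"
    and const: "\<And>a. a \<in> A \<Longrightarrow> Q (mconst a)"
    and var: "\<And>v. v \<in> V \<Longrightarrow> Q (mvar v)"
    and add: "\<And>p q. Q p \<Longrightarrow> Q q \<Longrightarrow> Q (p + q)"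
    and mult: "\<And>p q. Q p \<Longrightarrow> Q q \<Longrightarrow> Q (p * q)"
    and A: "csubring A"
  shows "Q p"
proof -
  interpret csubring A by fact
  have Q0: "Q 0" using const[OF zero_mem] by (simp add: mconst_def)
  have Q1: "Q 1" using const[OF one_mem] by (simp add: mconst_def)
  have Qpow: "Q (a ^ k)" if "Q a" for a k
    using that by (induction k) (auto simp: Q1 mult)
  have Qprod: "Q (prod f F)" if "\<And>i. i \<in> F \<Longrightarrow> Q (f i)" for f :: "'v \<Rightarrow> _" and F
    using that by (induction F rule: infinite_finite_induct) (auto simp: Q1 mult)
  have Qsum: "Q (sum f F)" if "\<And>i. i \<in> F \<Longrightarrow> Q (f i)" for f :: "('v \<Rightarrow>\<^sub>0 nat) \<Rightarrow> _" and F
    using that by (induction F rule: infinite_finite_induct) (auto simp: Q0 add)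
  have "Q (\<Sum>\<alpha>\<in>Poly_Mapping.keys p. Poly_Mapping.single \<alpha> (Poly_Mapping.lookup p \<alpha>))"
    unfolding single_eq_mconst_mvar
    using assms(1) by (intro Qsum mult Qprod Qpow const var) (auto simp: mcarrier_def)
  then show ?thesis by (simp add: sum_single_keys)
qed

text \<open>Evaluation at the origin kills every monomial except the empty product. Hence taking the
  constant term is a ring homomorphism.\<close>

lemma lookup_zero_eq_meval:
  fixes p :: "('v, 'a::comm_ring_1) mpoly"
  shows "Poly_Mapping.lookup p 0 = meval (\<lambda>a. a) (\<lambda>_. 0) p"
proof -
  have "(\<Prod>j\<in>Poly_Mapping.keys \<alpha>. (0::'a) ^ Poly_Mapping.lookup \<alpha> j) = (1 when \<alpha> = 0)" for \<alpha> :: "'v \<Rightarrow>\<^sub>0 nat"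
  proof (cases "\<alpha> = 0")
    case False
    then obtain j where "j \<in> Poly_Mapping.keys \<alpha>" by (metis keys_eq_empty ex_in_conv)
    then have "(\<Prod>j\<in>Poly_Mapping.keys \<alpha>. (0::'a) ^ Poly_Mapping.lookup \<alpha> j) = 0"
      by (intro prod_zero) (auto simp: in_keys_iff zero_power intro!: bexI[of _ j])
    then show ?thesis using False by simp
  qed simp
  then have "meval (\<lambda>a. a) (\<lambda>_. 0) p = (\<Sum>\<alpha>\<in>Poly_Mapping.keys p. Poly_Mapping.lookup p \<alpha> when \<alpha> = 0)"
    unfolding meval_def by (intro sum.cong) (auto simp: when_def)
  also have "\<dots> = (\<Sum>\<alpha>\<in>Poly_Mapping.keys p \<inter> {0}. Poly_Mapping.lookup p \<alpha>)"
    by (intro sum.mono_neutral_cong_right) (auto simp: when_def)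
  also have "\<dots> = Poly_Mapping.lookup p 0"
    by (cases "0 \<in> Poly_Mapping.keys p") (auto simp: in_keys_iff)
  finally show ?thesis by simp
qed

lemma rhom_lookup_zero: "rhom (\<lambda>p :: ('v, 'a::comm_ring_1) mpoly. Poly_Mapping.lookup p 0)"
  unfolding lookup_zero_eq_meval by (rule rhom.rhom_meval[OF rhom_id])

lemma lookup_mconst_zero [simp]: "Poly_Mapping.lookup (mconst a) 0 = a"
  by (simp add: mconst_def)

text \<open>A polynomial without constant term lies in every ideal that contains the variables. The
  map \<open>g\<close> allows two readings: with \<open>mconst\<close> it concerns coefficients of
  elements of T and the variables \<open>x_i\<close>, with the identity it concerns elements of T
  and the variables \<open>y_i\<close>.\<close>

lemma minus_const_in_ideal:
  fixes g :: "('v, 'a::comm_ring_1) mpoly \<Rightarrow> 'b::comm_ring_1"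
  assumes A: "csubring A" and g: "rhom g" and B: "ideal_in B Q"
    and gB: "\<And>p. p \<in> mcarrier A V \<Longrightarrow> g p \<in> B"
    and var: "\<And>i. i \<in> V \<Longrightarrow> g (mvar i) \<in> Q"
    and p: "p \<in> mcarrier A V"
  shows "g (p - mconst (Poly_Mapping.lookup p 0)) \<in> Q"
proof -
  interpret g: rhom g by fact
  interpret l: rhom "\<lambda>p :: ('v, 'a) mpoly. Poly_Mapping.lookup p 0" by (rule rhom_lookup_zero)
  interpret c: rhom "mconst :: 'a \<Rightarrow> ('v, 'a) mpoly" by (rule rhom_mconst)
  interpret csubring "mcarrier A V" by (rule csubring.csubring_mcarrier[OF A])
  have const: "mconst a \<in> mcarrier A V" if "a \<in> A" for a
    using that by (rule csubring.mconst_mcarrier[OF A])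
  have "p \<in> mcarrier A V \<and> g (p - mconst (Poly_Mapping.lookup p 0)) \<in> Q"
    using p
  proof (induction rule: mcarrier_induct)
    case (const a)
    then show ?case using csubring.mconst_mcarrier[OF A] B by (simp add: g.hom_zero ideal_inD(2))
  next
    case (var v)
    have "mvar v \<in> mcarrier A V"
      using var by (rule csubring.mvar_mcarrier[OF A])
    moreover have "Poly_Mapping.lookup (mvar v) 0 = (0::'a)"
      unfolding lookup_zero_eq_meval by (simp add: rhom.meval_mvar[OF rhom_id])
    ultimately show ?case using assms(5)[OF var] by (simp add: c.hom_zero)
  next
    case (add p q)
    let ?c = "\<lambda>p. mconst (Poly_Mapping.lookup p 0)"
    have "p + q - ?c (p + q) = (p - ?c p) + (q - ?c q)"
      by (simp add: l.hom_add c.hom_add)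
    then have "g (p + q - ?c (p + q)) = g (p - ?c p) + g (q - ?c q)"
      by (simp only: g.hom_add)
    then show ?case using add ideal_inD(3)[OF B] by (simp add: add_mem)
  next
    case (mult p q)
    let ?c = "\<lambda>p. mconst (Poly_Mapping.lookup p 0)"
    \<comment> \<open>A product rule for subtracting the constant term; it explains why the
      induction also carries membership in the carrier.\<close>
    have "p * q - ?c (p * q) = p * (q - ?c q) + ?c q * (p - ?c p)"
      by (simp add: l.hom_mult c.hom_mult algebra_simps)
    then have "g (p * q - ?c (p * q)) = g p * g (q - ?c q) + g (?c q) * g (p - ?c p)"
      by (simp only: g.hom_mult g.hom_add)
    then show ?case using mult const
      by (simp only:) (auto intro!: mult_mem ideal_inD(3)[OF B] ideal_inD(4)[OF B] gB csubring.lookup_mcarrier[OF A])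
  qed (rule A)
  then show ?thesis ..
qed

text \<open>Reduction modulo the first \<open>i\<close> variables, realised as an endomorphism
  instead of a quotient map. Its kernels form the standard maximal chain of primes of a polynomial
  ring.\<close>

definition trunc :: "nat \<Rightarrow> (nat, 'a::comm_ring_1) mpoly \<Rightarrow> (nat, 'a) mpoly" where
  "trunc i = meval mconst (\<lambda>j. if j < i then 0 else mvar j)"

lemma rhom_trunc: "rhom (trunc i)"
  unfolding trunc_def by (rule rhom.rhom_meval[OF rhom_mconst])

lemma trunc_mvar: "trunc i (mvar j) = (if j < i then 0 else mvar j)"
  unfolding trunc_def by (rule rhom.meval_mvar[OF rhom_mconst])

lemma trunc_0: "trunc 0 p = p"
  by (simp add: trunc_def meval_mconst_mvar)

lemma trunc_trunc:
  assumes "i \<le> k"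
  shows "trunc k (trunc i p) = trunc k p"
proof -
  have "trunc k (trunc i p) = meval (\<lambda>a. trunc k (mconst a)) (\<lambda>j. trunc k (if j < i then 0 else mvar j)) p"
    unfolding trunc_def[of i] by (rule rhom.hom_meval[OF rhom_trunc])
  also have "(\<lambda>a. trunc k (mconst a)) = mconst"
    unfolding trunc_def by (simp add: rhom.meval_mconst[OF rhom_mconst])
  also have "(\<lambda>j. trunc k (if j < i then 0 else mvar j)) = (\<lambda>j. if j < k then 0 else mvar j)"
    using assms by (auto simp: trunc_mvar rhom.hom_zero[OF rhom_trunc])
  finally show ?thesis by (simp add: trunc_def)
qed

lemma mvar_neq_0: "mvar j \<noteq> (0 :: (nat, 'a::comm_ring_1) mpoly)"
  by (metis mvar_def lookup_single_eq lookup_zero zero_neq_one)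

lemma rees_map_eq_meval: "rees_map fs = meval (\<lambda>a. [:a:]) (\<lambda>j. monom (fs ! j) 1)"
  by (rule ext) (simp add: rees_map_def meval_def)

lemma rhom_pCons: "rhom (\<lambda>a. [:a:])"
  by unfold_locales (simp_all add: one_pCons)

lemma rhom_coeff_0: "rhom (\<lambda>p. coeff p 0)"
  by unfold_locales (simp_all add: coeff_mult)

text \<open>The polynomial \<open>p(s x)\<close> in \<open>s\<close>, whose coefficients are the homogeneous components of \<open>p\<close>.\<close>

definition grading :: "('v, 'a::comm_ring_1) mpoly \<Rightarrow> ('v, 'a) mpoly poly" where
  "grading = meval (\<lambda>a. [:mconst a:]) (\<lambda>v. monom (mvar v) 1)"

lemma rhom_grading: "rhom (grading :: ('v, 'a::comm_ring_1) mpoly \<Rightarrow> _)"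
  unfolding grading_def by (intro rhom.rhom_meval rhom_compose[OF rhom_pCons rhom_mconst])

lemma grading_mconst: "grading (mconst a) = [:mconst a:]"
  unfolding grading_def by (intro rhom.meval_mconst rhom_compose[OF rhom_pCons rhom_mconst])

lemma grading_eq_sum:
  "grading p = (\<Sum>\<alpha>\<in>Poly_Mapping.keys p. monom (Poly_Mapping.single \<alpha> (Poly_Mapping.lookup p \<alpha>)) (mdegree \<alpha>))"
proof -
  have prod: "(\<Prod>j\<in>S. monom (f j) (Suc 0) ^ k j) = monom (\<Prod>j\<in>S. f j ^ k j) (\<Sum>j\<in>S. k j)"
    for S and f :: "'a \<Rightarrow> ('a, 'b) mpoly" and k
    by (induction S rule: infinite_finite_induct) (simp_all add: monom_power mult_monom)
  show ?thesis
    unfolding grading_def meval_def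
    by (rule sum.cong) (simp_all add: prod single_eq_mconst_mvar mdegree_def smult_monom)
qed

lemma coeff_grading:
  "coeff (grading p) d = (\<Sum>\<alpha>\<in>{\<alpha>\<in>Poly_Mapping.keys p. mdegree \<alpha> = d}. Poly_Mapping.single \<alpha> (Poly_Mapping.lookup p \<alpha>))"
  unfolding grading_eq_sum coeff_sum by (simp add: sum.inter_filter)

lemma coeff_grading_homogeneous:
  assumes "homogeneous e p"
  shows "coeff (grading p) d = (if d = e then p else 0)"
proof -
  have "{\<alpha>\<in>Poly_Mapping.keys p. mdegree \<alpha> = d} = (if d = e then Poly_Mapping.keys p else {})"
    using assms by (auto simp: homogeneous_def)
  then show ?thesis by (simp add: coeff_grading sum_single_keys)
qed

lemma homogeneous_coeff_grading: "homogeneous d (coeff (grading p) d)"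
proof -
  have "Poly_Mapping.keys (coeff (grading p) d) \<subseteq> {\<alpha>. mdegree \<alpha> = d}"
    unfolding coeff_grading
    by (rule order.trans[OF keys_sum]) auto
  then show ?thesis by (auto simp: homogeneous_def)
qed

lemma coeff_grading_0:
  fixes p :: "('v, 'a::comm_ring_1) mpoly"
  assumes "Poly_Mapping.lookup p 0 = 0"
  shows "coeff (grading p) 0 = 0"
proof -
  have "\<alpha> = 0" if "mdegree \<alpha> = 0" for \<alpha> :: "'v \<Rightarrow>\<^sub>0 nat"
    using that by (auto simp: mdegree_def in_keys_iff intro!: poly_mapping_eqI)
  then have "Poly_Mapping.single \<alpha> (Poly_Mapping.lookup p \<alpha>) = 0" if "mdegree \<alpha> = 0" for \<alpha>
    using \<open>\<And>\<alpha>. mdegree \<alpha> = 0 \<Longrightarrow> \<alpha> = 0\<close>[OF that] assms by simp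
  then show ?thesis
    unfolding coeff_grading by (intro sum.neutral) auto
qed

lemma (in csubring) coeff_grading_mcarrier:
  "p \<in> mcarrier A V \<Longrightarrow> coeff (grading p) d \<in> mcarrier A V"
  unfolding coeff_grading by (intro mcarrier_sum mcarrier_single) (auto simp: mcarrier_def)

section \<open>Bases modulo a subspace\<close>

context field_rhom
begin

text \<open>Linear independence of G modulo W, expressed by completing some basis B of W instead of
  by a quotient space. That G spans modulo W is stated separately where it is needed.\<close>

definition basis_mod :: "'b set \<Rightarrow> 'b set \<Rightarrow> bool" where
  "basis_mod W G \<longleftrightarrow> (\<exists>B. vs.independent (B \<union> G) \<and> B \<inter> G = {} \<and> vs.span B = W)"

text \<open>A basis of W is extended using elements of S only. S is arbitrary so that a basis of I
  modulo \<mm>I can be drawn from the given generators as well as from the homogeneous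
  elements.\<close>

lemma exists_basis_mod:
  assumes "vs.subspace W"
  obtains G where "G \<subseteq> S" "basis_mod W G" "S \<subseteq> vs.span (W \<union> G)"
proof -
  obtain B where B: "B \<subseteq> W" "vs.independent B" "W \<subseteq> vs.span B"
    using vs.maximal_independent_subset[of W] by blast
  obtain B' where B': "B \<subseteq> B'" "B' \<subseteq> B \<union> S" "vs.independent B'" "B \<union> S \<subseteq> vs.span B'"
    using vs.maximal_independent_subset_extend[of B "B \<union> S"] B(2) by blast
  have spanB: "vs.span B = W" using vs.span_minimal[OF B(1) assms] B(3) by auto
  show ?thesis
  proof (rule that[of "B' - B"])
    show "basis_mod W (B' - B)"
      unfolding basis_mod_def using B' spanB by (intro exI[of _ B]) (auto simp: Un_absorb1)
    have "vs.span B' \<subseteq> vs.span (W \<union> (B' - B))" using B(1) by (intro vs.span_mono) auto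
    then show "S \<subseteq> vs.span (W \<union> (B' - B))" using B'(4) by auto
  qed (use B' in auto)
qed

text \<open>This replaces linear maps out of the quotient by W: prescribe the values \<phi> on G and
  0 on a basis of W, then extend.\<close>

lemma basis_mod_linear:
  assumes "basis_mod W G"
  obtains \<Lambda> where "Vector_Spaces.linear (\<lambda>c b. \<kappa> c * b) (\<lambda>c b. \<kappa> c * b) \<Lambda>" "\<And>g. g \<in> G \<Longrightarrow> \<Lambda> g = \<phi> g" "\<And>w. w \<in> W \<Longrightarrow> \<Lambda> w = 0"
proof -
  interpret vp: vector_space_pair "\<lambda>c b. \<kappa> c * b" "\<lambda>c b. \<kappa> c * b" by unfold_locales
  obtain B where B: "vs.independent (B \<union> G)" "B \<inter> G = {}" "vs.span B = W"
    using assms by (auto simp: basis_mod_def)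
  obtain \<Lambda> where \<Lambda>: "Vector_Spaces.linear (\<lambda>c b. \<kappa> c * b) (\<lambda>c b. \<kappa> c * b) \<Lambda>" "\<forall>x\<in>B \<union> G. \<Lambda> x = (if x \<in> G then \<phi> x else 0)"
    using vp.linear_independent_extend[OF B(1), of "\<lambda>x. if x \<in> G then \<phi> x else 0"] by blast
  show ?thesis
  proof (rule that[OF \<Lambda>(1)])
    show "\<Lambda> w = 0" if "w \<in> W" for w
    proof (rule vp.linear_eq_0_on_span[OF \<Lambda>(1)])
      show "\<Lambda> x = 0" if "x \<in> B" for x
        using \<Lambda>(2) B(2) that by auto
      show "w \<in> vs.span B" using B(3) that by simp
    qed
  qed (use \<Lambda> in auto)
qed

text \<open>A linear map that kills W and fixes G places G in the span of the image of S, where the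
  exchange bound applies.\<close>

lemma basis_mod_card_le:
  assumes G: "basis_mod W G" and S: "finite S" "G \<subseteq> vs.span (W \<union> S)"
  shows "finite G \<and> card G \<le> card S"
proof -
  interpret vp: vector_space_pair "\<lambda>c b. \<kappa> c * b" "\<lambda>c b. \<kappa> c * b" by unfold_locales
  obtain \<Lambda> where \<Lambda>: "Vector_Spaces.linear (\<lambda>c b. \<kappa> c * b) (\<lambda>c b. \<kappa> c * b) \<Lambda>" "\<And>g. g \<in> G \<Longrightarrow> \<Lambda> g = g" "\<And>w. w \<in> W \<Longrightarrow> \<Lambda> w = 0"
    using basis_mod_linear[OF G, of "\<lambda>g. g"] by metis
  have "vs.independent G"
    using G vs.independent_mono by (auto simp: basis_mod_def)
  have "G = \<Lambda> ` G" using \<Lambda>(2) by auto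
  also have "\<dots> \<subseteq> \<Lambda> ` vs.span (W \<union> S)" using S(2) by auto
  also have "\<dots> = vs.span (\<Lambda> ` (W \<union> S))"
    using vp.linear_span_image[OF \<Lambda>(1)] by simp
  also have "\<dots> \<subseteq> vs.span (insert 0 (\<Lambda> ` S))"
    using \<Lambda>(3) by (intro vs.span_mono) auto
  also have "\<dots> = vs.span (\<Lambda> ` S)" by (rule vs.span_insert_0)
  finally have "finite G \<and> card G \<le> card (\<Lambda> ` S)"
    using vs.independent_span_bound[of "\<Lambda> ` S" G] S \<open>vs.independent G\<close> by auto
  then show ?thesis using card_image_le[OF S(1), of \<Lambda>] by auto
qed

end

section \<open>Explicit chains of primes\<close>

interpretation mconst: field_rhom "mconst :: 'k::field \<Rightarrow> ('v, 'k) mpoly"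
  by (simp add: field_rhom_def rhom_mconst)

text \<open>Pullback along \<open>f\<close> of the chain of ideals generated by initial segments of
  the variables. An \<open>f\<close>-preimage of \<open>mvar i\<close> lies in the step
  \<open>Suc i\<close> but not in the step \<open>i\<close>.\<close>

lemma prime_chain_trunc:
  fixes f :: "'a::comm_ring_1 \<Rightarrow> (nat, 'k::field) mpoly"
  assumes A: "csubring A" and f: "rhom f"
    and var: "\<And>i. i < d \<Longrightarrow> \<exists>a\<in>A. f a = mvar i"
  shows "prime_chain A (\<lambda>i. {a \<in> A. trunc i (f a) = 0}) d"
  unfolding prime_chain_def
proof (intro conjI allI impI)
  fix i
  show "prime_in A {a \<in> A. trunc i (f a) = 0}"
    by (rule csubring.prime_in_kernel[OF A rhom_compose[OF rhom_trunc f]])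
  assume "i < d"
  then obtain a where a: "a \<in> A" "f a = mvar i" using var by auto
  have "trunc (Suc i) (f a) = 0" if "trunc i (f a) = 0" for a
    using trunc_trunc[of i "Suc i" "f a"] that by (simp add: rhom.hom_zero[OF rhom_trunc])
  moreover have "trunc (Suc i) (f a) = 0" "trunc i (f a) \<noteq> 0"
    using a(2) by (simp_all add: trunc_mvar mvar_neq_0)
  ultimately show "{a \<in> A. trunc i (f a) = 0} \<subset> {a \<in> A. trunc (Suc i) (f a) = 0}"
    using a(1) by auto
qed

text \<open>The chain consists of the preimages of \<open>0\<close> and of the ideals \<open>(t, x\<^sub>0, \<dots>, x\<^sub>i\<^sub>-\<^sub>1)\<close>
  of \<open>K[x\<^sub>0, \<dots>, x\<^sub>n\<^sub>-\<^sub>1, t]\<close>.\<close>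

lemma prime_chain_trunc_coeff_0:
  fixes f :: "'a::comm_ring_1 \<Rightarrow> (nat, 'k::field) mpoly poly"
  assumes A: "csubring A" and f: "rhom f"
    and var: "\<And>i. i < n \<Longrightarrow> \<exists>a\<in>A. f a = [:mvar i:]"
    and "a \<in> A" "f a \<noteq> 0" "coeff (f a) 0 = 0"
  shows "\<exists>P. prime_chain A P (Suc n) \<and> P 0 = {a \<in> A. f a = 0}"
proof -
  let ?Q = "\<lambda>i. {a \<in> A. trunc i (coeff (f a) 0) = 0}"
  define P where "P = case_nat {a \<in> A. f a = 0} ?Q"
  have Q: "prime_chain A ?Q n"
  proof (rule prime_chain_trunc[OF A rhom_compose[OF rhom_coeff_0 f]])
    show "\<exists>a\<in>A. coeff (f a) 0 = mvar i" if "i < n" for i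
      using var[OF that] by (metis coeff_pCons_0)
  qed
  \<comment> \<open>The given \<open>a\<close> separates the two: \<open>f a\<close> is nonzero but
    divisible by t.\<close>
  have "P 0 \<subset> P 1"
    using assms(4-6) by (auto simp: P_def trunc_0)
  moreover have "prime_in A (P 0)"
    using csubring.prime_in_kernel[OF A f] by (simp add: P_def)
  ultimately have "prime_chain A P (Suc n)"
    using Q unfolding prime_chain_def P_def by (auto split: nat.split simp: less_Suc_eq_0_disj)
  then show ?thesis by (intro exI[of _ P]) (simp add: P_def)
qed

section \<open>Minimal generators of a graded ideal\<close>

locale generated_ideal =
  fixes n :: nat and fs :: "(nat, 'k::field) mpoly list"
  assumes fs: "set fs \<subseteq> mcarrier UNIV {..<n}"
begin

abbreviation "R \<equiv> mcarrier UNIV {..<n} :: (nat, 'k) mpoly set"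

definition T :: "(nat, (nat, 'k) mpoly) mpoly set" where
  "T = mcarrier R {..<length fs}"

sublocale R: csubring R by (rule csubring.csubring_mcarrier[OF csubring_UNIV])

sublocale T: csubring T unfolding T_def by (rule R.csubring_mcarrier)

definition I :: "(nat, 'k) mpoly set" where
  "I = {\<Sum>i<length fs. a i * fs ! i | a. \<forall>i. a i \<in> R}"

text \<open>The product \<mm>I: coefficients with vanishing constant term are exactly the elements
  of \<mm>.\<close>

definition mI :: "(nat, 'k) mpoly set" where
  "mI = {\<Sum>i<length fs. a i * fs ! i | a. \<forall>i. a i \<in> R \<and> Poly_Mapping.lookup (a i) 0 = 0}"

sublocale const: rhom "\<lambda>p :: (nat, 'k) mpoly. Poly_Mapping.lookup p 0" by (rule rhom_lookup_zero)

lemma mconst_R: "mconst c \<in> R"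
  by (rule csubring.mconst_mcarrier[OF csubring_UNIV]) simp

lemma mvar_R: "i < n \<Longrightarrow> mvar i \<in> R"
  by (rule csubring.mvar_mcarrier[OF csubring_UNIV]) simp

lemma mconst_T: "a \<in> R \<Longrightarrow> mconst a \<in> T"
  unfolding T_def by (rule R.mconst_mcarrier)

lemma mvar_T: "i < length fs \<Longrightarrow> mvar i \<in> T"
  unfolding T_def by (rule R.mvar_mcarrier) simp

lemma nth_R: "i < length fs \<Longrightarrow> fs ! i \<in> R"
  using fs by auto

lemma sum_delta_mult:
  "i < length fs \<Longrightarrow> (\<Sum>j<length fs. (if j = i then 1 else 0) * F j) = (F i :: 'b::comm_ring_1)"
  by (simp add: if_distrib[of "\<lambda>x. x * _"] cong: if_cong)

lemma nth_I:
  assumes "i < length fs"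
  shows "fs ! i \<in> I"
  unfolding I_def mem_Collect_eq
  by (rule exI[of _ "\<lambda>j. if j = i then 1 else 0"]) (auto simp: sum_delta_mult assms R.one_mem R.zero_mem)

lemma ideal_I: "ideal_in R I"
  unfolding ideal_in_def
proof (intro conjI ballI)
  show "I \<subseteq> R" unfolding I_def by (auto intro!: R.sum_mem R.mult_mem nth_R)
  show "0 \<in> I" unfolding I_def mem_Collect_eq
    by (rule exI[of _ "\<lambda>_. 0"]) (simp add: R.zero_mem)
  fix x y assume "y \<in> I"
  then obtain b where b: "\<And>i. b i \<in> R" "y = (\<Sum>i<length fs. b i * fs ! i)" by (auto simp: I_def)
  { assume "x \<in> I"
    then obtain a where a: "\<And>i. a i \<in> R" "x = (\<Sum>i<length fs. a i * fs ! i)" by (auto simp: I_def)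
    show "x + y \<in> I" unfolding I_def mem_Collect_eq
      by (rule exI[of _ "\<lambda>i. a i + b i"]) (simp add: a b R.add_mem sum.distrib algebra_simps)
  }
  { assume "x \<in> R"
    then show "x * y \<in> I" unfolding I_def mem_Collect_eq
      by (intro exI[of _ "\<lambda>i. x * b i"]) (simp add: b R.mult_mem sum_distrib_left ac_simps)
  }
qed

lemma genideal_fs: "Idl\<^bsub>subring_of R\<^esub> (set fs) = I"
proof
  show "Idl\<^bsub>subring_of R\<^esub> (set fs) \<subseteq> I"
    using nth_I by (intro genideal_subring_of(3)[OF R.csubring_axioms fs ideal_I]) (auto simp: in_set_conv_nth)
  note J = genideal_subring_of[OF R.csubring_axioms fs]
  show "I \<subseteq> Idl\<^bsub>subring_of R\<^esub> (set fs)"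
    unfolding I_def using J(2) by (auto intro!: ideal_in_sum[OF J(1)] ideal_inD(4)[OF J(1)])
qed

lemma subspace_mI: "mconst.vs.subspace mI"
proof (rule mconst.vs.subspaceI)
  show "0 \<in> mI" unfolding mI_def mem_Collect_eq
    by (rule exI[of _ "\<lambda>_. 0"]) (simp add: R.zero_mem)
  fix x c assume "x \<in> mI"
  then obtain a where a: "\<forall>i. a i \<in> R \<and> Poly_Mapping.lookup (a i) 0 = 0"
    "x = (\<Sum>i<length fs. a i * fs ! i)" unfolding mI_def by blast
  show "mconst c * x \<in> mI" unfolding mI_def mem_Collect_eq
    by (intro exI[of _ "\<lambda>i. mconst c * a i"])
      (simp add: a R.mult_mem mconst_R const.hom_mult sum_distrib_left ac_simps)
  fix y assume "y \<in> mI"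
  then obtain b where b: "\<forall>i. b i \<in> R \<and> Poly_Mapping.lookup (b i) 0 = 0"
    "y = (\<Sum>i<length fs. b i * fs ! i)" unfolding mI_def by blast
  show "x + y \<in> mI" unfolding mI_def mem_Collect_eq
    by (rule exI[of _ "\<lambda>i. a i + b i"])
      (simp add: a b R.add_mem const.hom_add sum.distrib algebra_simps)
qed

lemma mult_mI:
  assumes "a \<in> R" "Poly_Mapping.lookup a 0 = 0" "p \<in> I"
  shows "a * p \<in> mI"
proof -
  obtain b where b: "\<And>i. b i \<in> R" "p = (\<Sum>i<length fs. b i * fs ! i)"
    using assms(3) by (auto simp: I_def)
  show ?thesis unfolding mI_def mem_Collect_eq
    by (rule exI[of _ "\<lambda>i. a * b i"])
      (simp add: assms b R.mult_mem const.hom_mult sum_distrib_left ac_simps)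
qed

text \<open>A coefficient is its constant term plus an element of \<mm>, so ideal generators of I
  span it over K modulo \<mm>I.\<close>

lemma span_mod_mI:
  assumes "S \<subseteq> R" "I = Idl\<^bsub>subring_of R\<^esub> S"
  shows "I \<subseteq> mconst.vs.span (mI \<union> S)"
proof -
  note J = genideal_subring_of[OF R.csubring_axioms assms(1)]
  have "ideal_in R {p \<in> I. p \<in> mconst.vs.span (mI \<union> S)}"
    unfolding ideal_in_def
  proof (intro conjI ballI)
    fix a p assume a: "a \<in> R" and p: "p \<in> {p \<in> I. p \<in> mconst.vs.span (mI \<union> S)}"
    let ?c = "mconst (Poly_Mapping.lookup a 0)"
    have "(a - ?c) * p \<in> mconst.vs.span (mI \<union> S)"
      using a p by (intro mconst.vs.span_base UnI1 mult_mI)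
        (auto simp: const.hom_diff R.diff_mem mconst_R)
    then have "?c * p + (a - ?c) * p \<in> mconst.vs.span (mI \<union> S)"
      using p by (intro mconst.vs.span_add mconst.vs.span_scale) auto
    moreover have "?c * p + (a - ?c) * p = a * p" by (simp add: algebra_simps)
    ultimately show "a * p \<in> {p \<in> I. p \<in> mconst.vs.span (mI \<union> S)}"
      using ideal_inD(4)[OF ideal_I a] p by simp
  qed (use ideal_inD[OF ideal_I] in \<open>auto intro: mconst.vs.span_add mconst.vs.span_zero\<close>)
  then have "Idl\<^bsub>subring_of R\<^esub> S \<subseteq> {p \<in> I. p \<in> mconst.vs.span (mI \<union> S)}"
    using J(2) assms(2) by (intro J(3)) (auto intro: mconst.vs.span_base)
  then show ?thesis using assms(2) by auto
qed

lemma mem_span_mI: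
  assumes "finite G" "p \<in> mconst.vs.span (mI \<union> G)"
  obtains a c where "\<And>i. a i \<in> R" "\<And>i. Poly_Mapping.lookup (a i) 0 = 0"
    "p = (\<Sum>i<length fs. a i * fs ! i) + (\<Sum>g\<in>G. mconst (c g) * g)"
proof -
  obtain w g where "p = w + g" "w \<in> mconst.vs.span mI" "g \<in> mconst.vs.span G"
    using assms(2) unfolding mconst.vs.span_Un by auto
  moreover have "w \<in> mI" using calculation(2) subspace_mI by (simp add: mconst.vs.span_eq_iff[THEN iffD2])
  ultimately show ?thesis
    using that mconst.vs.span_finite[OF assms(1)] unfolding mI_def by auto
qed

text \<open>The dimension of the \<open>K\<close>-space \<open>I / \<mm>I\<close>.\<close>

definition dim_fibre :: nat where
  "dim_fibre = (SOME d. \<exists>G. G \<subseteq> set fs \<and> mconst.basis_mod mI G \<and> I \<subseteq> mconst.vs.span (mI \<union> G) \<and> d = card G)"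

lemma basis_mod_in_gens:
  assumes "S \<subseteq> R" "I = Idl\<^bsub>subring_of R\<^esub> S"
  obtains G where "G \<subseteq> S" "mconst.basis_mod mI G" "I \<subseteq> mconst.vs.span (mI \<union> G)"
proof -
  obtain G where G: "G \<subseteq> S" "mconst.basis_mod mI G" "S \<subseteq> mconst.vs.span (mI \<union> G)"
    using mconst.exists_basis_mod[OF subspace_mI] by metis
  have "mconst.vs.span (mI \<union> S) \<subseteq> mconst.vs.span (mI \<union> G)"
    using G(3) by (intro mconst.vs.span_minimal) (auto intro: mconst.vs.span_base)
  then show ?thesis using that[OF G(1,2)] span_mod_mI[OF assms] by auto
qed

lemma dim_fibre_basis:
  obtains G where "G \<subseteq> set fs" "mconst.basis_mod mI G" "I \<subseteq> mconst.vs.span (mI \<union> G)" "dim_fibre = card G"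
proof -
  have "\<exists>d G. G \<subseteq> set fs \<and> mconst.basis_mod mI G \<and> I \<subseteq> mconst.vs.span (mI \<union> G) \<and> d = card G"
    using basis_mod_in_gens[OF fs genideal_fs[symmetric]] by metis
  from someI_ex[OF this] show ?thesis using that unfolding dim_fibre_def by blast
qed

lemma dim_fibre_le:
  assumes "S \<subseteq> R" "finite S" "I = Idl\<^bsub>subring_of R\<^esub> S"
  shows "dim_fibre \<le> card S"
proof -
  obtain G where G: "G \<subseteq> set fs" "mconst.basis_mod mI G" "dim_fibre = card G"
    using dim_fibre_basis by metis
  have "set fs \<subseteq> I" using nth_I by (auto simp: in_set_conv_nth)
  then have "G \<subseteq> I" using G(1) by auto
  then show ?thesis
    using mconst.basis_mod_card_le[OF G(2) assms(2)] span_mod_mI[OF assms(1,3)] G(3) by auto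
qed

text \<open>The polynomials whose components all lie in I form an ideal, because components of a
  product are convolution sums. This ideal contains the homogeneous elements of I, which generate
  I.\<close>

lemma coeff_grading_I:
  assumes graded: "I = Idl\<^bsub>subring_of R\<^esub> {p \<in> I. \<exists>d. homogeneous d p}"
    and p: "p \<in> I"
  shows "coeff (grading p) d \<in> I"
proof -
  let ?Q = "{p \<in> R. \<forall>d. coeff (grading p) d \<in> I}"
  note I = ideal_inD[OF ideal_I]
  interpret g: rhom grading by (rule rhom_grading)
  have "ideal_in R ?Q"
    unfolding ideal_in_def
    by (auto simp: g.hom_zero g.hom_add g.hom_mult coeff_mult R.zero_mem R.add_mem R.mult_mem
        intro!: I(2-4) ideal_in_sum[OF ideal_I] csubring.coeff_grading_mcarrier[OF csubring_UNIV])
  moreover have "{p \<in> I. \<exists>d. homogeneous d p} \<subseteq> ?Q"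
    using I(1) by (auto simp: coeff_grading_homogeneous I(2))
  moreover have "{p \<in> I. \<exists>d. homogeneous d p} \<subseteq> R" using I(1) by auto
  ultimately have "Idl\<^bsub>subring_of R\<^esub> {p \<in> I. \<exists>d. homogeneous d p} \<subseteq> ?Q"
    using genideal_subring_of(3)[OF R.csubring_axioms] by blast
  then show ?thesis using p graded by auto
qed

text \<open>Induction on the degree replaces localisation. In degree \<open>e\<close>, a combination
  of the \<open>f_i\<close> with coefficients in \<mm> involves only components of the
  \<open>f_i\<close> of degree below \<open>e\<close>. These lie in I because I is graded, and in
  the ideal generated by G by induction.\<close>

lemma graded_Nakayama:
  assumes graded: "I = Idl\<^bsub>subring_of R\<^esub> {p \<in> I. \<exists>d. homogeneous d p}"
    and G: "finite G" "G \<subseteq> {p \<in> I. \<exists>d. homogeneous d p}" "I \<subseteq> mconst.vs.span (mI \<union> G)"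
  shows "I = Idl\<^bsub>subring_of R\<^esub> G"
proof
  interpret g: rhom grading by (rule rhom_grading)
  have GR: "G \<subseteq> R" using G(2) ideal_inD(1)[OF ideal_I] by auto
  note K = genideal_subring_of[OF R.csubring_axioms GR]
  note K' = ideal_inD[OF K(1)]
  show "Idl\<^bsub>subring_of R\<^esub> G \<subseteq> I" using G(2) by (intro K(3)[OF ideal_I]) auto
  have "p \<in> Idl\<^bsub>subring_of R\<^esub> G" if "p \<in> I" "homogeneous e p" for p e
    using that
  proof (induction e arbitrary: p rule: less_induct)
    case (less e)
    obtain a c where a: "\<And>i. a i \<in> R" "\<And>i. Poly_Mapping.lookup (a i) 0 = 0"
      "p = (\<Sum>i<length fs. a i * fs ! i) + (\<Sum>g\<in>G. mconst (c g) * g)"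
      using mem_span_mI[OF G(1)] G(3) less.prems(1) by blast
    have "p = coeff (grading p) e" using less.prems(2) by (simp add: coeff_grading_homogeneous)
    also have "\<dots> = (\<Sum>i<length fs. \<Sum>s\<le>e. coeff (grading (a i)) s * coeff (grading (fs ! i)) (e - s)) +
        (\<Sum>g\<in>G. mconst (c g) * coeff (grading g) e)"
      unfolding a(3) by (simp add: g.hom_add g.hom_sum g.hom_mult coeff_sum coeff_mult[of "grading (a _)"] grading_mconst)
    also have "\<dots> \<in> Idl\<^bsub>subring_of R\<^esub> G"
    proof (intro K'(3) ideal_in_sum[OF K(1)])
      fix i s assume i: "i \<in> {..<length fs}" and s: "s \<in> {..e}"
      \<comment> \<open>For \<open>s = 0\<close> the component of \<open>a i\<close> is its constant
        term, which is 0; otherwise \<open>e - s < e\<close>.\<close>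
      show "coeff (grading (a i)) s * coeff (grading (fs ! i)) (e - s) \<in> Idl\<^bsub>subring_of R\<^esub> G"
      proof (cases "s = 0")
        case False
        have "coeff (grading (fs ! i)) (e - s) \<in> Idl\<^bsub>subring_of R\<^esub> G"
          using False s i by (intro less.IH[of "e - s"] coeff_grading_I[OF graded] homogeneous_coeff_grading nth_I) auto
        then show ?thesis
          using a(1) by (intro K'(4) csubring.coeff_grading_mcarrier[OF csubring_UNIV])
      qed (simp add: coeff_grading_0 a K'(2))
    next
      fix g assume g: "g \<in> G"
      then obtain d where "homogeneous d g" using G(2) by auto
      then have "coeff (grading g) e \<in> Idl\<^bsub>subring_of R\<^esub> G"
        using g K(2) by (auto simp: coeff_grading_homogeneous K'(2))
      then show "mconst (c g) * coeff (grading g) e \<in> Idl\<^bsub>subring_of R\<^esub> G"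
        by (intro K'(4) mconst_R)
    qed
    finally show ?case .
  qed
  then have "Idl\<^bsub>subring_of R\<^esub> {p \<in> I. \<exists>d. homogeneous d p} \<subseteq> Idl\<^bsub>subring_of R\<^esub> G"
    using ideal_inD(1)[OF ideal_I]
    by (intro genideal_subring_of(3)[OF R.csubring_axioms _ K(1)]) auto
  then show "I \<subseteq> Idl\<^bsub>subring_of R\<^esub> G" using graded by simp
qed

text \<open>A basis modulo \<mm>I made of homogeneous elements generates I by Nakayama. Comparison
  with the basis taken from the finite list \<open>fs\<close> shows that it is finite with at most
  \<open>dim_fibre\<close> elements.\<close>

lemma min_num_gens_I:
  assumes graded: "I = Idl\<^bsub>subring_of R\<^esub> {p \<in> I. \<exists>d. homogeneous d p}"
  shows "min_num_gens (subring_of R) I = enat dim_fibre"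
proof (rule antisym)
  let ?H = "{p \<in> I. \<exists>d. homogeneous d p}"
  have HR: "?H \<subseteq> R" using ideal_inD(1)[OF ideal_I] by auto
  obtain G where G: "G \<subseteq> ?H" "mconst.basis_mod mI G" "I \<subseteq> mconst.vs.span (mI \<union> G)"
    using basis_mod_in_gens[OF HR graded] .
  obtain G' where G': "G' \<subseteq> set fs" "mconst.basis_mod mI G'" "I \<subseteq> mconst.vs.span (mI \<union> G')" "dim_fibre = card G'"
    using dim_fibre_basis .
  have "finite G'" using G'(1) finite_subset by auto
  then have le: "finite G" "card G \<le> dim_fibre"
    using mconst.basis_mod_card_le[OF G(2), of G'] G'(3,4) G(1) by auto
  have "I = Idl\<^bsub>subring_of R\<^esub> G" using graded_Nakayama[OF graded le(1) G(1,3)] .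
  then have "min_num_gens (subring_of R) I \<le> enat (card G)"
    unfolding min_num_gens_def using G(1) HR le(1) by (intro INF_lower) auto
  then show "min_num_gens (subring_of R) I \<le> enat dim_fibre"
    using le(2) by (meson enat_ord_simps(1) order.trans)
  show "enat dim_fibre \<le> min_num_gens (subring_of R) I"
    unfolding min_num_gens_def using dim_fibre_le by (intro INF_greatest) auto
qed

end

section \<open>Dimensions of the Rees algebra and the symmetric algebra\<close>

context generated_ideal
begin

section \<open>The homomorphism \<open>\<phi>\<close> and the ideals J and L of T\<close>

abbreviation "\<phi> \<equiv> rees_map fs"

sublocale phi: rhom \<phi>
  unfolding rees_map_eq_meval by (rule rhom.rhom_meval[OF rhom_pCons])

lemma phi_mconst: "\<phi> (mconst a) = [:a:]"
  unfolding rees_map_eq_meval by (rule rhom.meval_mconst[OF rhom_pCons])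

lemma phi_mvar: "\<phi> (mvar j) = monom (fs ! j) 1"
  unfolding rees_map_eq_meval by (rule rhom.meval_mvar[OF rhom_pCons])

definition rees_carrier :: "(nat, 'k) mpoly poly set" where
  "rees_carrier = generate_ring (subring_of UNIV) ((\<lambda>a. [:a:]) ` R \<union> (\<lambda>f. monom f 1) ` set fs)"

abbreviation "J \<equiv> rees_ideal R fs"
abbreviation "L \<equiv> linear_relations_ideal R fs"

lemma rees_source_eq: "rees_source R fs = subring_of T"
  by (simp add: rees_source_def mpoly_ring_eq T_def)

lemma J_eq: "J = {p \<in> T. \<phi> p = 0}"
  by (simp add: rees_ideal_def rees_source_eq rees_algebra_def a_kernel_def')

lemma ideal_L: "ideal_in T L"
  and relation_in_L: "\<lbrakk>\<And>i. i < length fs \<Longrightarrow> a i \<in> R; (\<Sum>i<length fs. a i * fs ! i) = 0\<rbrakk> \<Longrightarrow>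
    (\<Sum>i<length fs. mconst (a i) * mvar i) \<in> L"
  and L_minimal: "\<lbrakk>ideal_in T Q;
    \<And>a. (\<And>i. i < length fs \<Longrightarrow> a i \<in> R) \<Longrightarrow> (\<Sum>i<length fs. a i * fs ! i) = 0 \<Longrightarrow>
      (\<Sum>i<length fs. mconst (a i) * mvar i) \<in> Q\<rbrakk> \<Longrightarrow> L \<subseteq> Q"
proof -
  let ?rel = "{\<Sum>i<length fs. mconst (a i) * mvar i | a.
      (\<forall>i<length fs. a i \<in> R) \<and> (\<Sum>i<length fs. a i * fs ! i) = 0}"
  have "?rel \<subseteq> T"
    by (auto intro!: T.sum_mem T.mult_mem mconst_T mvar_T)
  note gen = genideal_subring_of[OF T.csubring_axioms this]
  have L: "L = Idl\<^bsub>subring_of T\<^esub> ?rel"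
    by (simp add: linear_relations_ideal_def rees_source_eq)
  show "ideal_in T L" unfolding L by (rule gen(1))
  { assume "\<And>i. i < length fs \<Longrightarrow> a i \<in> R" "(\<Sum>i<length fs. a i * fs ! i) = 0"
    then show "(\<Sum>i<length fs. mconst (a i) * mvar i) \<in> L"
      unfolding L using gen(2) by blast }
  { assume Q: "ideal_in T Q"
      and rel: "\<And>a. (\<And>i. i < length fs \<Longrightarrow> a i \<in> R) \<Longrightarrow> (\<Sum>i<length fs. a i * fs ! i) = 0 \<Longrightarrow>
        (\<Sum>i<length fs. mconst (a i) * mvar i) \<in> Q"
    show "L \<subseteq> Q" unfolding L using rel by (intro gen(3)[OF Q]) auto }
qed

text \<open>\<open>\<phi>\<close> sends a linear form with coefficients \<open>a i\<close> to the
  sum of the \<open>a i * fs ! i\<close>, times t.\<close>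

lemma L_subset_J: "L \<subseteq> J"
proof (rule L_minimal)
  show "ideal_in T J"
    unfolding J_eq using T.prime_in_kernel[OF phi.rhom_axioms] by (simp add: prime_in_def)
  fix a assume a: "\<And>i. i < length fs \<Longrightarrow> a i \<in> R" "(\<Sum>i<length fs. a i * fs ! i) = 0"
  have "\<phi> (\<Sum>i<length fs. mconst (a i) * mvar i) = (\<Sum>i<length fs. monom (a i * fs ! i) 1)"
    by (simp add: phi.hom_sum phi.hom_mult phi_mconst phi_mvar smult_monom)
  also have "\<dots> = monom (\<Sum>i<length fs. a i * fs ! i) 1"
    by (induction "length fs") (simp_all add: add_monom flip: monom_sum)
  finally have "\<phi> (\<Sum>i<length fs. mconst (a i) * mvar i) = 0" by (simp add: a)
  then show "(\<Sum>i<length fs. mconst (a i) * mvar i) \<in> J"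
    unfolding J_eq using a by (auto intro!: T.sum_mem T.mult_mem mconst_T mvar_T)
qed

lemma csubring_rees_carrier: "csubring rees_carrier"
proof
  have minus: "\<ominus>\<^bsub>subring_of UNIV\<^esub> a = - a" for a :: "(nat, 'k) mpoly poly"
    by (rule csubring.a_inv_subring_of[OF csubring_UNIV]) simp
  show "1 \<in> rees_carrier"
    unfolding rees_carrier_def using generate_ring.one[of "subring_of UNIV"] by simp
  fix a b assume "a \<in> rees_carrier" "b \<in> rees_carrier"
  then show "a - b \<in> rees_carrier" "a * b \<in> rees_carrier"
    unfolding rees_carrier_def
    using generate_ring.eng_add[of a "subring_of UNIV" _ "- b"] generate_ring.a_inv[of b "subring_of UNIV"]
      generate_ring.eng_mult[of a "subring_of UNIV" _ b]
    by (auto simp: minus)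
qed

lemma const_rees_carrier: "a \<in> R \<Longrightarrow> [:a:] \<in> rees_carrier"
  unfolding rees_carrier_def by (intro generate_ring.incl) auto

lemma monom_rees_carrier: "i < length fs \<Longrightarrow> monom (fs ! i) 1 \<in> rees_carrier"
  unfolding rees_carrier_def by (intro generate_ring.incl) auto

text \<open>The n + 1 algebra generators \<open>x_0, ..., x_{n-1}, t\<close> of the ambient ring;
  index n stands for t.\<close>

definition coords :: "nat \<Rightarrow> (nat, 'k) mpoly poly" where
  "coords j = (if j < n then [:mvar j:] else monom 1 1)"

sublocale pc: field_rhom "\<lambda>c :: 'k. [:mconst c:] :: (nat, 'k) mpoly poly"
  unfolding field_rhom_def by (rule rhom_compose[OF rhom_pCons rhom_mconst])

sublocale adj: csubring "adjoin (\<lambda>c. [:mconst c:]) coords (Suc n)"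
  by (rule pc.csubring_adjoin)

lemma const_adjoin:
  assumes "p \<in> R"
  shows "[:p:] \<in> adjoin (\<lambda>c. [:mconst c:]) coords (Suc n)"
  using assms
proof (induction rule: mcarrier_induct)
  case (var i)
  then show ?case using pc.adjoin_var[of i "Suc n" coords] by (simp add: coords_def[of i])
next
  case (add p q)
  then show ?case using adj.add_mem by fastforce
next
  case (mult p q)
  then show ?case using adj.mult_mem[of "[:p:]" "[:q:]"] by (simp add: mult.commute)
qed (use pc.adjoin_const csubring_UNIV in auto)

lemma monom_adjoin:
  assumes "p \<in> R"
  shows "monom p 1 \<in> adjoin (\<lambda>c. [:mconst c:]) coords (Suc n)"
  using adj.mult_mem[OF const_adjoin[OF assms] pc.adjoin_var[of n "Suc n" coords]]
  by (simp add: coords_def[of n] smult_monom)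

lemma rees_carrier_adjoin: "rees_carrier \<subseteq> adjoin (\<lambda>c. [:mconst c:]) coords (Suc n)"
proof
  fix p assume "p \<in> rees_carrier"
  then show "p \<in> adjoin (\<lambda>c. [:mconst c:]) coords (Suc n)"
    unfolding rees_carrier_def
  proof (induction rule: generate_ring.induct)
    case (incl h)
    then show ?case using const_adjoin monom_adjoin fs by auto
  next
    case (a_inv h)
    then show ?case
      using adj.uminus_mem by (simp add: csubring.a_inv_subring_of[OF csubring_UNIV])
  qed (use adj.one_mem adj.add_mem adj.mult_mem in auto)
qed

lemma phi_adjoin:
  assumes "p \<in> T"
  shows "\<phi> p \<in> adjoin (\<lambda>c. [:mconst c:]) coords (Suc n)"
  using assms unfolding T_def
proof (induction rule: mcarrier_induct)
  case (const a)
  then show ?case by (simp add: phi_mconst const_adjoin)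
next
  case (var i)
  then show ?case using monom_adjoin[OF nth_R] by (simp add: phi_mvar)
qed (auto simp: phi.hom_add phi.hom_mult adj.add_mem adj.mult_mem R.csubring_axioms)

section \<open>Dimensions of R and of the Rees algebra, and chains of primes above J\<close>

lemma krull_dim_R: "krull_dim (subring_of R) = ereal (real n)"
  unfolding R.krull_dim_subring_of
proof (rule SUP_nat_eq_ereal)
  have "prime_chain R (\<lambda>i. {a \<in> R. trunc i a = 0}) n"
    using mvar_R by (intro prime_chain_trunc[OF R.csubring_axioms rhom_id]) auto
  then show "n \<in> {k. \<exists>P. prime_chain R P k}" by blast
  fix k assume "k \<in> {k. \<exists>P. prime_chain R P k}"
  then obtain P where P: "prime_chain R P k" by auto
  then have I: "ideal_in R (P 0)" by (auto simp: prime_chain_def prime_in_def)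
  show "k \<le> n"
  proof (rule prime_chain_length_le[OF R.csubring_axioms rhom_mconst _ P rhom_id])
    fix a assume a: "a \<in> R"
    have "a \<in> adjoin mconst mvar n"
      using a
    proof (induction rule: mcarrier_induct)
      case (const a)
      show ?case by (rule mconst.adjoin_const)
    next
      case (var i)
      then show ?case by (auto intro: mconst.adjoin_var)
    qed (auto intro: mconst.adjoin_add mconst.adjoin_mult csubring_UNIV)
    then show "\<exists>a'\<in>R. a - a' \<in> P 0 \<and> a' \<in> adjoin mconst mvar n"
      using a ideal_inD(2)[OF I] by (intro bexI[of _ a]) auto
  qed (use mconst_R ideal_inD(2)[OF I] in auto)
qed

text \<open>For a nonzero generator \<open>f_i\<close> the element \<open>f_i t\<close> provides the
  additional step between 0 and the primes containing t.\<close>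

lemma krull_dim_rees:
  assumes "i < length fs" "fs ! i \<noteq> 0"
  shows "krull_dim (rees_algebra R fs) = ereal (real (Suc n))"
proof -
  interpret csubring rees_carrier by (rule csubring_rees_carrier)
  have eq: "rees_algebra R fs = subring_of rees_carrier"
    by (simp add: rees_algebra_def rees_carrier_def)
  show ?thesis unfolding eq krull_dim_subring_of
  proof (rule SUP_nat_eq_ereal)
    have "\<exists>P. prime_chain rees_carrier P (Suc n) \<and> P 0 = {a \<in> rees_carrier. a = 0}"
    proof (rule prime_chain_trunc_coeff_0[OF csubring_axioms rhom_id])
      show "\<exists>a\<in>rees_carrier. a = [:mvar i:]" if "i < n" for i
        using const_rees_carrier[OF mvar_R[OF that]] by auto
    qed (use monom_rees_carrier[OF assms(1)] assms(2) in auto)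
    then show "Suc n \<in> {k. \<exists>P. prime_chain rees_carrier P k}" by blast
    fix k assume "k \<in> {k. \<exists>P. prime_chain rees_carrier P k}"
    then obtain P where P: "prime_chain rees_carrier P k" by auto
    then have I: "ideal_in rees_carrier (P 0)" by (auto simp: prime_chain_def prime_in_def)
    show "k \<le> Suc n"
    proof (rule prime_chain_length_le[OF csubring_axioms pc.rhom_axioms _ P rhom_id])
      show "\<exists>a'\<in>rees_carrier. a - a' \<in> P 0 \<and> a' \<in> adjoin (\<lambda>c. [:mconst c:]) coords (Suc n)"
        if "a \<in> rees_carrier" for a
        using that rees_carrier_adjoin ideal_inD(2)[OF I] by (intro bexI[of _ a]) auto
    qed (use const_rees_carrier mconst_R ideal_inD(2)[OF I] in auto)
  qed
qed

text \<open>The chain used for the Rees algebra, pulled back to T along \<open>\<phi>\<close>; its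
  bottom is J, which contains L.\<close>

lemma chain_above_J:
  assumes "i < length fs" "fs ! i \<noteq> 0"
  shows "\<exists>P. prime_chain T P (Suc n) \<and> L \<subseteq> P 0"
proof -
  have "\<exists>P. prime_chain T P (Suc n) \<and> P 0 = {a \<in> T. \<phi> a = 0}"
  proof (rule prime_chain_trunc_coeff_0[OF T.csubring_axioms phi.rhom_axioms])
    show "\<exists>a\<in>T. \<phi> a = [:mvar i:]" if "i < n" for i
      using mconst_T[OF mvar_R[OF that]] phi_mconst by auto
    show "mvar i \<in> T" "\<phi> (mvar i) \<noteq> 0" "coeff (\<phi> (mvar i)) 0 = 0"
      using assms by (auto simp: phi_mvar mvar_T)
  qed
  then show ?thesis using L_subset_J by (auto simp: J_eq)
qed

lemma chain_above_J_le:
  assumes P: "prime_chain T P k" and J: "J \<subseteq> P 0"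
  shows "k \<le> Suc n"
proof (rule prime_chain_length_le[OF T.csubring_axioms rhom_compose[OF rhom_mconst rhom_mconst] _ P phi.rhom_axioms])
  have I: "ideal_in T (P 0)" using P by (auto simp: prime_chain_def prime_in_def)
  show "a \<in> P 0" if "a \<in> T" "\<phi> a = 0" for a using that J by (auto simp: J_eq)
  show "\<exists>a'\<in>T. a - a' \<in> P 0 \<and> \<phi> a' \<in> adjoin (\<lambda>c. \<phi> (mconst (mconst c))) coords (Suc n)"
    if "a \<in> T" for a
    using that phi_adjoin ideal_inD(2)[OF I] by (intro bexI[of _ a]) (auto simp: phi_mconst)
qed (auto intro: mconst_T mconst_R)

text \<open>Evaluates one coefficient vector in two places: on the \<open>f_l\<close> in R, where
  the result vanishes and exhibits a relation, and on the \<open>y_l\<close> in T, where it is the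
  corresponding linear form.\<close>

lemma linear_form_decomposition:
  assumes g: "rhom g" and i: "i < length fs" and b: "\<And>j. j < d \<Longrightarrow> b j < length fs"
  shows "(\<Sum>l<length fs. g ((if l = i then 1 else 0) - (\<Sum>j<d. if b j = l then c j else 0) - a l) * F l) =
    F i - (\<Sum>j<d. g (c j) * F (b j)) - (\<Sum>l<length fs. g (a l) * F l)"
proof -
  interpret g: rhom g by fact
  have "(\<Sum>l<length fs. (\<Sum>j<d. if b j = l then g (c j) else 0) * F l) =
      (\<Sum>j<d. \<Sum>l<length fs. if b j = l then g (c j) * F l else 0)"
    unfolding sum_distrib_right by (subst sum.swap) (intro sum.cong refl, auto)
  also have "\<dots> = (\<Sum>j<d. g (c j) * F (b j))"
    using b by (intro sum.cong refl) auto
  finally have 1: "(\<Sum>l<length fs. (\<Sum>j<d. if b j = l then g (c j) else 0) * F l) = (\<Sum>j<d. g (c j) * F (b j))" .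
  have "g (if P then 1 else 0) = (if P then 1 else 0)" "g (if P then x else 0) = (if P then g x else 0)" for P x
    by (simp_all add: g.hom_zero g.hom_one)
  then show ?thesis
    using sum_delta_mult[OF i, of F]
    by (simp add: g.hom_diff g.hom_sum g.hom_one left_diff_distrib sum_subtractf 1)
qed

text \<open>Passes from a set of basis elements to positions in \<open>fs\<close>, since the
  variables \<open>y_j\<close> are tied to positions; repeated entries contribute one position
  only.\<close>

lemma dim_fibre_indices:
  obtains b where "\<And>j. j < dim_fibre \<Longrightarrow> b j < length fs"
    "inj_on (\<lambda>j. fs ! b j) {..<dim_fibre}"
    "mconst.basis_mod mI ((\<lambda>j. fs ! b j) ` {..<dim_fibre})"
    "I \<subseteq> mconst.vs.span (mI \<union> (\<lambda>j. fs ! b j) ` {..<dim_fibre})"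
proof -
  obtain G where G: "G \<subseteq> set fs" "mconst.basis_mod mI G" "I \<subseteq> mconst.vs.span (mI \<union> G)" "dim_fibre = card G"
    using dim_fibre_basis .
  have "finite G" using G(1) finite_subset by auto
  then obtain g where g: "bij_betw g {..<dim_fibre} G"
    using ex_bij_betw_nat_finite[of G] G(4) by (auto simp: atLeast0LessThan)
  have "\<forall>j. \<exists>l. j < dim_fibre \<longrightarrow> l < length fs \<and> fs ! l = g j"
    using bij_betw_apply[OF g] G(1) by (metis in_set_conv_nth lessThan_iff subset_iff)
  then obtain b where b: "\<And>j. j < dim_fibre \<Longrightarrow> b j < length fs \<and> fs ! b j = g j" by metis
  have "(\<lambda>j. fs ! b j) ` {..<dim_fibre} = G" "inj_on (\<lambda>j. fs ! b j) {..<dim_fibre}"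
    using g b by (auto simp: bij_betw_def inj_on_def)
  then show ?thesis using that[of b] b G by auto
qed

text \<open>Modulo \<open>P 0\<close> every coefficient becomes a constant and every
  \<open>y_i\<close> a K-linear combination of the \<open>y_{b j}\<close>, so
  \<open>dim_fibre\<close> elements generate T up to \<open>P 0\<close>.\<close>

lemma chain_above_fibre_le:
  assumes P: "prime_chain T P k" and L: "L \<subseteq> P 0"
    and x: "\<And>i. i < n \<Longrightarrow> mconst (mvar i) \<in> P 0"
  shows "k \<le> dim_fibre"
proof -
  have I: "ideal_in T (P 0)" using P by (auto simp: prime_chain_def prime_in_def)
  obtain b where b: "\<And>j. j < dim_fibre \<Longrightarrow> b j < length fs"
    "inj_on (\<lambda>j. fs ! b j) {..<dim_fibre}"
    "I \<subseteq> mconst.vs.span (mI \<union> (\<lambda>j. fs ! b j) ` {..<dim_fibre})"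
    using dim_fibre_indices by metis
  interpret mc: field_rhom "\<lambda>c :: 'k. mconst (mconst c) :: (nat, (nat, 'k) mpoly) mpoly"
    unfolding field_rhom_def by (rule rhom_compose[OF rhom_mconst rhom_mconst])
  let ?A = "adjoin (\<lambda>c :: 'k. mconst (mconst c :: (nat, 'k) mpoly)) (\<lambda>j. mvar (b j)) dim_fibre
    :: (nat, (nat, 'k) mpoly) mpoly set"
  interpret A: csubring ?A by (rule mc.csubring_adjoin)
  have maximal: "mconst (p - mconst (Poly_Mapping.lookup p 0)) \<in> P 0" if "p \<in> R" for p
    using that x by (intro minus_const_in_ideal[OF csubring_UNIV rhom_mconst I]) (auto intro: mconst_T)
  have approx: "\<exists>a'. a' \<in> T \<and> a' \<in> ?A \<and> a - a' \<in> P 0" if "a \<in> T" for a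
    using that unfolding T_def
  proof (induction rule: mcarrier_induct)
    case (const p)
    have "mconst (mconst (Poly_Mapping.lookup p 0)) \<in> T" by (intro mconst_T mconst_R)
    then show ?case
      using maximal[OF const] mc.adjoin_const T_def
      by (intro exI[of _ "mconst (mconst (Poly_Mapping.lookup p 0))"])
        (auto simp: rhom.hom_diff[OF rhom_mconst])
  next
    case (var i)
    then have i: "i < length fs" by simp
    obtain a c where a: "\<And>i. a i \<in> R" "\<And>i. Poly_Mapping.lookup (a i) 0 = 0"
      "fs ! i = (\<Sum>i<length fs. a i * fs ! i) + (\<Sum>g\<in>(\<lambda>j. fs ! b j) ` {..<dim_fibre}. mconst (c g) * g)"
      using mem_span_mI[of "(\<lambda>j. fs ! b j) ` {..<dim_fibre}" "fs ! i"] b(3) nth_I[OF i] by blast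
    define c' where "c' = (\<lambda>j. mconst (c (fs ! b j)) :: (nat, 'k) mpoly)"
    have c'R: "c' j \<in> R" for j by (simp add: c'_def mconst_R)
    \<comment> \<open>The expression of \<open>f_i\<close> through the basis modulo \<mm>I, moved to
      one side, is a syzygy of \<open>fs\<close>; its linear form lies in L.\<close>
    let ?a = "\<lambda>l. (if l = i then 1 else 0) - (\<Sum>j<dim_fibre. if b j = l then c' j else 0) - a l"
    have "(\<Sum>l<length fs. ?a l * fs ! l) = 0"
      using linear_form_decomposition[OF rhom_id i b(1), where c = c' and a = a and F = "\<lambda>l. fs ! l"] a(3)
      by (simp add: sum.reindex[OF b(2)] c'_def)
    moreover have "?a l \<in> R" for l
      by (intro R.diff_mem R.sum_mem) (auto simp: R.one_mem R.zero_mem c'R a)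
    ultimately have "(\<Sum>l<length fs. mconst (?a l) * mvar l) \<in> P 0"
      using L relation_in_L[of ?a] by blast
    \<comment> \<open>The correction from \<mm>I has coefficients in \<mm> and therefore disappears
      modulo \<open>P 0\<close>.\<close>
    moreover have "(\<Sum>l<length fs. mconst (a l) * mvar l) \<in> P 0"
      using maximal[OF a(1)] a(2)
      by (intro ideal_in_sum[OF I] ideal_inD(5)[OF I] mvar_T) (auto simp: rhom.hom_zero[OF rhom_mconst])
    ultimately have "mvar i - (\<Sum>j<dim_fibre. mconst (c' j) * mvar (b j)) \<in> P 0"
      using linear_form_decomposition[OF rhom_mconst i b(1), where c = c' and a = a and F = mvar] ideal_inD(3)[OF I]
      by fastforce
    moreover have "(\<Sum>j<dim_fibre. mconst (c' j) * mvar (b j)) \<in> ?A"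
      unfolding c'_def using mc.adjoin_var[of _ dim_fibre "\<lambda>j. mvar (b j)"]
      by (intro A.sum_mem A.mult_mem mc.adjoin_const) auto
    moreover have "(\<Sum>j<dim_fibre. mconst (c' j) * mvar (b j)) \<in> T"
      by (intro T.sum_mem T.mult_mem mconst_T mvar_T c'R b(1)) auto
    ultimately show ?case unfolding T_def by blast
  next
    case (add p q)
    then obtain p' q' where "p' \<in> T" "p' \<in> ?A" "p - p' \<in> P 0" "q' \<in> T" "q' \<in> ?A" "q - q' \<in> P 0"
      by (auto simp: T_def)
    then show ?case
      using ideal_inD(3)[OF I, of "p - p'" "q - q'"] T.add_mem A.add_mem
      by (intro exI[of _ "p' + q'"]) (auto simp: algebra_simps T_def)
  next
    case (mult p q)
    then obtain p' q' where *: "p' \<in> T" "p' \<in> ?A" "p - p' \<in> P 0" "q' \<in> T" "q' \<in> ?A" "q - q' \<in> P 0"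
      by (auto simp: T_def)
    have "p = (p - p') + p'" by simp
    then have "p \<in> T" using * ideal_inD(1)[OF I] T.add_mem by (metis subsetD)
    \<comment> \<open>This is \<open>p * q - p' * q'\<close>, split into two multiples of elements
      of \<open>P 0\<close>.\<close>
    then have "p * (q - q') + (p - p') * q' \<in> P 0"
      using * by (intro ideal_inD(3)[OF I] ideal_inD(4)[OF I, of p] ideal_inD(5)[OF I]) auto
    then show ?case using * T.mult_mem A.mult_mem
      by (intro exI[of _ "p' * q'"]) (auto simp: algebra_simps T_def)
  qed (rule R.csubring_axioms)
  show ?thesis
  proof (rule prime_chain_length_le[OF T.csubring_axioms mc.rhom_axioms _ P rhom_id])
    show "\<exists>a'\<in>T. a - a' \<in> P 0 \<and> a' \<in> ?A" if "a \<in> T" for a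
      using approx[OF that] by blast
  qed (use ideal_inD(2)[OF I] in \<open>auto intro: mconst_T mconst_R\<close>)
qed

text \<open>\<psi> maps T to a polynomial ring with \<open>dim_fibre\<close> relevant variables:
  coefficients go to their constant terms and \<open>y_i\<close> to \<open>\<Lambda> (f_i)\<close>,
  where \<Lambda> kills \<mm>I and sends the basis elements to distinct variables. The target reuses
  the type of R, but its variables are unrelated to the \<open>x_i\<close>.\<close>

lemma chain_above_fibre: "\<exists>P. prime_chain T P dim_fibre \<and> L \<subseteq> P 0"
proof -
  obtain b where b: "\<And>j. j < dim_fibre \<Longrightarrow> b j < length fs"
    "inj_on (\<lambda>j. fs ! b j) {..<dim_fibre}"
    "mconst.basis_mod mI ((\<lambda>j. fs ! b j) ` {..<dim_fibre})"
    using dim_fibre_indices by metis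
  obtain \<Lambda> where \<Lambda>: "Vector_Spaces.linear (\<lambda>c b. mconst c * b) (\<lambda>c b. mconst c * b) \<Lambda>"
    "\<And>g. g \<in> (\<lambda>j. fs ! b j) ` {..<dim_fibre} \<Longrightarrow> \<Lambda> g = mvar (the_inv_into {..<dim_fibre} (\<lambda>j. fs ! b j) g)"
    "\<And>w. w \<in> mI \<Longrightarrow> \<Lambda> w = (0 :: (nat, 'k) mpoly)"
    using mconst.basis_mod_linear[OF b(3), of "\<lambda>g. mvar (the_inv_into {..<dim_fibre} (\<lambda>j. fs ! b j) g)"] by blast
  interpret \<Lambda>: Vector_Spaces.linear "\<lambda>c b. mconst c * b" "\<lambda>c b. mconst c * b" \<Lambda> by (rule \<Lambda>(1))
  define \<psi> where "\<psi> = meval (\<lambda>a :: (nat, 'k) mpoly. mconst (Poly_Mapping.lookup a 0)) (\<lambda>i. \<Lambda> (fs ! i))"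
  have hom: "rhom (\<lambda>a :: (nat, 'k) mpoly. mconst (Poly_Mapping.lookup a 0) :: (nat, 'k) mpoly)"
    by (rule rhom_compose[OF rhom_mconst rhom_lookup_zero])
  have \<psi>: "rhom \<psi>" unfolding \<psi>_def by (rule rhom.rhom_meval[OF hom])
  interpret \<psi>: rhom \<psi> by (rule \<psi>)
  have \<psi>_mconst: "\<psi> (mconst a) = mconst (Poly_Mapping.lookup a 0)" for a
    unfolding \<psi>_def by (rule rhom.meval_mconst[OF hom])
  have \<psi>_mvar: "\<psi> (mvar i) = \<Lambda> (fs ! i)" for i
    unfolding \<psi>_def by (rule rhom.meval_mvar[OF hom])
  have chain: "prime_chain T (\<lambda>i. {a \<in> T. trunc i (\<psi> a) = 0}) dim_fibre"
  proof (rule prime_chain_trunc[OF T.csubring_axioms \<psi>])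
    show "\<exists>a\<in>T. \<psi> a = mvar i" if "i < dim_fibre" for i
    proof
      show "mvar (b i) \<in> T" by (rule mvar_T[OF b(1)[OF that]])
      show "\<psi> (mvar (b i)) = mvar i"
        using \<Lambda>(2)[of "fs ! b i"] the_inv_into_f_f[OF b(2), of i] that by (simp add: \<psi>_mvar)
    qed
  qed
  have "L \<subseteq> {a \<in> T. trunc 0 (\<psi> a) = 0}"
  proof (rule L_minimal)
    show "ideal_in T {a \<in> T. trunc 0 (\<psi> a) = 0}"
      using chain by (auto simp: prime_chain_def prime_in_def)
    fix a assume a: "\<And>i. i < length fs \<Longrightarrow> a i \<in> R" "(\<Sum>i<length fs. a i * fs ! i) = 0"
    \<comment> \<open>The \<mm>-part of the relation. It contributes an element of \<mm>I, so
      \<Lambda> turns the remaining constant part into a relation among the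
      \<open>\<Lambda> (f_i)\<close>. The default 0 is needed because \<open>mI\<close> constrains
      the coefficients at all indices.\<close>
    define a' where "a' = (\<lambda>i. if i < length fs then a i - mconst (Poly_Mapping.lookup (a i) 0) else 0)"
    have "(\<Sum>i<length fs. a' i * fs ! i) \<in> mI"
      unfolding mI_def mem_Collect_eq using a(1)
      by (intro exI[of _ a']) (auto simp: a'_def const.hom_diff intro!: R.diff_mem mconst_R R.zero_mem)
    then have "\<Lambda> (\<Sum>i<length fs. a' i * fs ! i) = 0" by (rule \<Lambda>(3))
    moreover have "(\<Sum>i<length fs. a' i * fs ! i) = - (\<Sum>i<length fs. mconst (Poly_Mapping.lookup (a i) 0) * fs ! i)"
      using a(2) by (simp add: a'_def left_diff_distrib sum_subtractf)
    ultimately have "(\<Sum>i<length fs. mconst (Poly_Mapping.lookup (a i) 0) * \<Lambda> (fs ! i)) = 0"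
      by (simp add: \<Lambda>.neg \<Lambda>.sum \<Lambda>.scale)
    then have "\<psi> (\<Sum>i<length fs. mconst (a i) * mvar i) = 0"
      by (simp add: \<psi>.hom_sum \<psi>.hom_mult \<psi>_mconst \<psi>_mvar)
    moreover have "(\<Sum>i<length fs. mconst (a i) * mvar i) \<in> T"
      using a by (auto intro!: T.sum_mem T.mult_mem mconst_T mvar_T)
    ultimately show "(\<Sum>i<length fs. mconst (a i) * mvar i) \<in> {a \<in> T. trunc 0 (\<psi> a) = 0}"
      by (simp add: trunc_0)
  qed
  then show ?thesis using chain by blast
qed

text \<open>When all generators vanish, each \<open>y_i\<close> is itself a linear relation. This
  excludes the zero ideal, for which the conductor would not be proper.\<close>

lemma J_subset_L_if_zero:
  assumes "\<And>i. i < length fs \<Longrightarrow> fs ! i = 0"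
  shows "J \<subseteq> L"
proof
  fix p assume "p \<in> J"
  then have p: "p \<in> T" "\<phi> p = 0" by (auto simp: J_eq)
  have mvar_L: "mvar i \<in> L" if "i < length fs" for i
  proof -
    have "(\<Sum>l<length fs. mconst (if l = i then 1 else 0) * mvar l) \<in> L"
      by (rule relation_in_L) (auto simp: R.one_mem R.zero_mem assms)
    moreover have "(\<Sum>l<length fs. mconst (if l = i then 1 else 0) * mvar l) =
        (\<Sum>l<length fs. (if l = i then 1 else 0) * mvar l :: (nat, (nat, 'k) mpoly) mpoly)"
      by (intro sum.cong refl) (auto simp: rhom.hom_zero[OF rhom_mconst] rhom.hom_one[OF rhom_mconst])
    ultimately show ?thesis by (simp only: sum_delta_mult[OF that])
  qed
  have "p - mconst (Poly_Mapping.lookup p 0) \<in> L"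
    using p(1) mvar_L unfolding T_def
    by (intro minus_const_in_ideal[OF R.csubring_axioms rhom_id ideal_L]) (auto simp: T_def)
  moreover from this have "\<phi> (p - mconst (Poly_Mapping.lookup p 0)) = 0"
    using L_subset_J by (auto simp: J_eq)
  \<comment> \<open>\<open>\<phi>\<close> is injective on constants, so an element of J whose
    nonconstant part lies in L has constant term 0.\<close>
  then have "mconst (Poly_Mapping.lookup p 0) = (0 :: (nat, (nat, 'k) mpoly) mpoly)"
    using p(2) by (simp add: phi.hom_diff phi_mconst rhom.hom_zero[OF rhom_mconst])
  ultimately show "p \<in> L" by simp
qed

section \<open>Dimension of the symmetric algebra and the equivalence\<close>

lemma krull_dim_sym:
  assumes i: "i < length fs" "fs ! i \<noteq> 0"
    and power: "\<And>i. i < n \<Longrightarrow> \<exists>k. mvar i ^ k \<in> conductor R fs"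
  shows "krull_dim (sym_algebra R fs) = ereal (real (max (Suc n) dim_fibre))"
  unfolding sym_algebra_def rees_source_eq T.krull_dim_quot[OF ideal_L]
proof (rule SUP_nat_eq_ereal)
  show "max (Suc n) dim_fibre \<in> {k. \<exists>P. prime_chain T P k \<and> L \<subseteq> P 0}"
    using chain_above_J[OF i] chain_above_fibre by (simp add: max_def)
  fix k assume "k \<in> {k. \<exists>P. prime_chain T P k \<and> L \<subseteq> P 0}"
  then obtain P where P: "prime_chain T P k" "L \<subseteq> P 0" by auto
  have prime: "prime_in T (P 0)" using P by (auto simp: prime_chain_def)
  show "k \<le> max (Suc n) dim_fibre"
  proof (cases "J \<subseteq> P 0")
    case True
    then show ?thesis using chain_above_J_le[OF P(1)] by simp
  next
    case False
    then obtain p where p: "p \<in> J" "p \<notin> P 0" by auto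
    \<comment> \<open>Some power of \<open>x_i\<close> multiplies \<open>p\<close> into L, hence
      into the prime \<open>P 0\<close>, which does not contain \<open>p\<close>.\<close>
    have "mconst (mvar i) \<in> P 0" if "i < n" for i
    proof -
      obtain k where "mvar i ^ k \<in> conductor R fs" using power[OF \<open>i < n\<close>] by auto
      then have "mconst (mvar i ^ k) * p \<in> P 0" using p P(2) by (auto simp: conductor_def)
      moreover have "mconst (mvar i) \<in> T" by (intro mconst_T mvar_R that)
      ultimately show ?thesis
        using prime p T.power_mem[of "mconst (mvar i)" k] prime_in_power[OF prime _ _ T.csubring_axioms]
        by (auto simp: prime_in_def J_eq rhom.hom_power[OF rhom_mconst])
    qed
    then show ?thesis using chain_above_fibre_le[OF P] by simp
  qed
qed

end

theorem proposition1p7: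
  fixes n :: nat
    and R :: "(nat, 'k::field) mpoly ring"
    and I :: "(nat, 'k) mpoly set"
    and fs :: "(nat, 'k) mpoly list"
  assumes "R = mpoly_ring UNIV {..<n}"
    and "graded_ideal I R"
    and "set fs \<subseteq> carrier R"
    and "I = Idl\<^bsub>R\<^esub> (set fs)"
    and "primary_to R (Idl\<^bsub>R\<^esub> (mvar ` {..<n})) (conductor (carrier R) fs)"
  shows "krull_dim (rees_algebra (carrier R) fs) = krull_dim (sym_algebra (carrier R) fs)
    \<longleftrightarrow> ereal_of_enat (min_num_gens R I) \<le> krull_dim R + 1"
proof -
  let ?A = "mcarrier UNIV {..<n} :: (nat, 'k) mpoly set"
  have R: "R = subring_of ?A" using assms(1) by (simp add: mpoly_ring_eq)
  interpret G: generated_ideal n fs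
    using assms(3) by unfold_locales (simp add: R)
  have I: "I = G.I" using assms(4) G.genideal_fs by (simp add: R)
  have graded: "G.I = Idl\<^bsub>subring_of ?A\<^esub> {p \<in> G.I. \<exists>d. homogeneous d p}"
    using assms(2) by (simp add: graded_ideal_def I R)
  let ?C = "conductor ?A fs"
  have C: "primary_ideal ?C R" "radical R ?C = Idl\<^bsub>R\<^esub> (mvar ` {..<n})"
    using assms(5) by (simp_all add: primary_to_def R)
  \<comment> \<open>Properness of a primary ideal yields an element of J outside L, and so a nonzero
    generator.\<close>
  have "?C \<noteq> ?A" using C(1) by (simp add: primary_ideal_def R)
  moreover have "?C \<subseteq> ?A" unfolding conductor_def by blast
  ultimately obtain r where "r \<in> ?A" "r \<notin> ?C" by blast
  then obtain p where rp: "r \<in> ?A" "p \<in> rees_ideal ?A fs" "mconst r * p \<notin> linear_relations_ideal ?A fs"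
    unfolding conductor_def by blast
  have "p \<notin> linear_relations_ideal ?A fs"
    using rp ideal_inD(4)[OF G.ideal_L G.mconst_T] by blast
  then obtain i where i: "i < length fs" "fs ! i \<noteq> 0"
    using G.J_subset_L_if_zero rp(2) by blast
  have "\<exists>k. mvar j ^ k \<in> ?C" if "j < n" for j
  proof -
    have "mvar ` {..<n} \<subseteq> ?A" using G.mvar_R by auto
    from genideal_subring_of(2)[OF G.R.csubring_axioms this]
    have "mvar j \<in> Idl\<^bsub>subring_of ?A\<^esub> (mvar ` {..<n})" by (rule subsetD) (use that in simp)
    then have "mvar j \<in> radical R ?C" unfolding C(2) unfolding R .
    then show ?thesis
      by (simp add: radical_def R G.R.pow_subring_of)
  qed
  then have sym: "krull_dim (sym_algebra ?A fs) = ereal (real (max (Suc n) G.dim_fibre))"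
    by (intro G.krull_dim_sym[OF i])
  \<comment> \<open>It remains that \<open>Suc n = max (Suc n) d\<close> holds exactly when
    \<open>d \<le> n + 1\<close>.\<close>
  show ?thesis
    unfolding R I subring_of_simps sym G.krull_dim_rees[OF i] G.min_num_gens_I[OF graded] G.krull_dim_R
    by (auto simp: max_def one_ereal_def)
qed

end
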